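(* There exist a universal constant $C>0$ and an integer $d_0$ such that, for every even integer $d\ge d_0$ and every integer $T\ge C\log d$, a parallel ORA walk $Q_T^{\mathrm{par}}\in O(d)$ with $T$ rounds satisfies, with probability at least $1-d^{-2}$, $$\|Q_T^{\mathrm{par}}\|_\infty\le C\sqrt{\frac{\log d}{d}}.$$
   Context: For a real matrix $M$, $\|M\|_\infty=\max_{i,j}|M_{ij}|$. Let $d$ be even. One parallel ORA round chooses a uniformly random permutation $\sigma$ of $\{1,\dots,d\}$, organizes the coordinates into the ordered pairs $(\sigma(1),\sigma(2)),(\sigma(3),\sigma(4)),\dots,(\sigma(d-1),\sigma(d))$, and applies the rotation $R_{\pi/4}=\frac1{\sqrt2}\begin{pmatrix}1&-1\\1&1\end{pmatrix}$ simultaneously to every ordered pair of coordinates. The resulting orthogonal $d\times d$ matrix is denoted $R_\sigma^{\mathrm{par}}$. A parallel ORA walk with $T$ rounds is $Q_T^{\mathrm{par}}=R_{\sigma_T}^{\mathrm{par}}\cdots R_{\sigma_1}^{\mathrm{par}}$ with $\sigma_1,\dots,\sigma_T$ independent and uniform. *)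

theory Defs
  imports "HOL-Probability.Probability" "HOL-Probability.Product_PMF" "Jordan_Normal_Form.Matrix"
begin

hide_const (open) Finite_Cartesian_Product.mat Finite_Cartesian_Product.vec
hide_type (open) Finite_Cartesian_Product.vec
no_notation Finite_Cartesian_Product.vec_nth (infixl \<open>$\<close> 90)
no_notation Inner_Product.real_inner_class.inner (infix \<open>\<bullet>\<close> 70)
no_notation m_inv (\<open>(\<open>open_block notation=\<open>prefix inv\<close>\<close>inv\<index> _)\<close> [81] 80)

text \<open>Matrices of varying dimension are modelled by \<^typ>\<open>real mat\<close>, whose rows and columns
  are indexed from 0; accordingly all coordinates are shifted by one, and the permutations act on
  \<open>{..<d}\<close>.\<close>

text \<open>The largest absolute value of an entry; only meaningful for nonempty matrices.\<close>

definition max_abs_norm :: "real mat \<Rightarrow> real" where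
  "max_abs_norm M = Max (abs ` elements_mat M)"

definition rot_quarter_pi :: "real mat" where
  "rot_quarter_pi = (1 / sqrt 2) \<cdot>\<^sub>m mat_of_rows_list 2 [[1, -1], [1, 1]]"

text \<open>For \<open>\<sigma>\<close> permuting \<open>{..<d}\<close> with \<open>d\<close> even, coordinate \<open>i\<close> occupies position \<open>inv \<sigma> i\<close> in the
  list \<open>\<sigma> 0, \<sigma> 1, \<dots>, \<sigma> (d - 1)\<close>. The ordered pairs are \<open>(\<sigma> (2 * k), \<sigma> (2 * k + 1))\<close>, so the position
  \<open>div\<close> 2 is the number of the pair, and the position \<open>mod\<close> 2 is the place within the pair.\<close>

definition par_round :: "nat \<Rightarrow> (nat \<Rightarrow> nat) \<Rightarrow> real mat" where
  "par_round d \<sigma> = mat d d (\<lambda>(i, j).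
     if inv \<sigma> i div 2 = inv \<sigma> j div 2
     then rot_quarter_pi $$ (inv \<sigma> i mod 2, inv \<sigma> j mod 2)
     else 0)"

primrec par_walk :: "nat \<Rightarrow> (nat \<Rightarrow> nat \<Rightarrow> nat) \<Rightarrow> nat \<Rightarrow> real mat" where
  "par_walk d \<sigma> 0 = 1\<^sub>m d"
| "par_walk d \<sigma> (Suc t) = par_round d (\<sigma> (Suc t)) * par_walk d \<sigma> t"

text \<open>The joint law of the independent uniform permutations \<open>\<sigma> 1, \<dots>, \<sigma> T\<close>; the second argument of
  \<^const>\<open>Pi_pmf\<close> is the irrelevant default value at the indices outside \<open>{1..T}\<close>.\<close>

definition par_perms_pmf :: "nat \<Rightarrow> nat \<Rightarrow> (nat \<Rightarrow> nat \<Rightarrow> nat) pmf" where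
  "par_perms_pmf d T = Pi_pmf {1..T} id (\<lambda>_. pmf_of_set {\<sigma>. \<sigma> permutes {..<d}})"

definition par_walk_pmf :: "nat \<Rightarrow> nat \<Rightarrow> real mat pmf" where
  "par_walk_pmf d T = map_pmf (\<lambda>\<sigma>. par_walk d \<sigma> T) (par_perms_pmf d T)"

text \<open>Sanity checks: a round acts on every ordered pair by the rotation, and the walk is orthogonal.\<close>

lemma rot_quarter_pi_index:
  "rot_quarter_pi $$ (0, 0) = 1 / sqrt 2" "rot_quarter_pi $$ (0, Suc 0) = - 1 / sqrt 2"
  "rot_quarter_pi $$ (Suc 0, 0) = 1 / sqrt 2" "rot_quarter_pi $$ (Suc 0, Suc 0) = 1 / sqrt 2"
  by (simp_all add: rot_quarter_pi_def mat_of_rows_list_def)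

lemma sum_over_pair:
  fixes f :: "nat \<Rightarrow> real"
  assumes "even d" "m < d"
  shows "(\<Sum>l<d. if m div 2 = l div 2 then f l else 0)
    = f (2 * (m div 2)) + f (2 * (m div 2) + 1)"
proof -
  have S: "{l. l < d \<and> m div 2 = l div 2} = {2 * (m div 2), 2 * (m div 2) + 1}"
  proof -
    obtain b where "d = 2 * b" using assms(1) by (rule evenE)
    with assms(2) have "2 * (m div 2) + 1 < d" by presburger
    then show ?thesis by auto
  qed
  have "(\<Sum>l<d. if m div 2 = l div 2 then f l else 0) = sum f {l. l < d \<and> m div 2 = l div 2}"
    by (subst sum.inter_filter[symmetric]) (auto intro: sum.cong)
  then show ?thesis by (simp add: S)
qed

lemma par_round_carrier: "par_round d \<sigma> \<in> carrier_mat d d"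
  by (simp add: par_round_def)

lemma par_round_action:
  assumes d: "even d" and \<sigma>: "\<sigma> permutes {..<d}" and k: "2 * k < d" and x: "x \<in> carrier_vec d"
  shows "(par_round d \<sigma> *\<^sub>v x) $ \<sigma> (2 * k) = (x $ \<sigma> (2 * k) - x $ \<sigma> (2 * k + 1)) / sqrt 2"
    and "(par_round d \<sigma> *\<^sub>v x) $ \<sigma> (2 * k + 1) = (x $ \<sigma> (2 * k) + x $ \<sigma> (2 * k + 1)) / sqrt 2"
proof -
  have main: "(par_round d \<sigma> *\<^sub>v x) $ \<sigma> m =
      rot_quarter_pi $$ (m mod 2, 0) * x $ \<sigma> (2 * (m div 2))
      + rot_quarter_pi $$ (m mod 2, Suc 0) * x $ \<sigma> (2 * (m div 2) + 1)" if m: "m < d" for m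
  proof -
    have lt: "\<sigma> l < d" if "l < d" for l
      using permutes_in_image[OF \<sigma>, of l] that by simp
    have i: "inv \<sigma> (\<sigma> l) = l" for l
      using permutes_inverses(2)[OF \<sigma>] .
    have "(par_round d \<sigma> *\<^sub>v x) $ \<sigma> m = (\<Sum>j<d. par_round d \<sigma> $$ (\<sigma> m, j) * x $ j)"
      using x lt[OF m] by (simp add: scalar_prod_def par_round_def lessThan_atLeast0)
    also have "\<dots> = (\<Sum>l<d. par_round d \<sigma> $$ (\<sigma> m, \<sigma> l) * x $ \<sigma> l)"
      by (rule sum.permute[OF \<sigma>, unfolded o_def])
    also have "\<dots> = (\<Sum>l<d. if m div 2 = l div 2
        then rot_quarter_pi $$ (m mod 2, l mod 2) * x $ \<sigma> l else 0)"
      by (rule sum.cong) (use m in \<open>auto simp: par_round_def lt i\<close>)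
    finally show ?thesis
      by (simp add: sum_over_pair[OF d m])
  qed
  have "2 * k + 1 < d" using d k by (auto elim!: evenE)
  moreover have "(2 * k + 1) mod 2 = Suc 0" "(2 * k + 1) div 2 = k"
    by presburger+
  ultimately have m1: "(par_round d \<sigma> *\<^sub>v x) $ \<sigma> (2 * k + 1) =
      rot_quarter_pi $$ (Suc 0, 0) * x $ \<sigma> (2 * k)
      + rot_quarter_pi $$ (Suc 0, Suc 0) * x $ \<sigma> (2 * k + 1)"
    using main[of "2 * k + 1"] by metis
  from main[OF k] m1 show
    "(par_round d \<sigma> *\<^sub>v x) $ \<sigma> (2 * k) = (x $ \<sigma> (2 * k) - x $ \<sigma> (2 * k + 1)) / sqrt 2"
    "(par_round d \<sigma> *\<^sub>v x) $ \<sigma> (2 * k + 1) = (x $ \<sigma> (2 * k) + x $ \<sigma> (2 * k + 1)) / sqrt 2"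
    by (simp_all add: rot_quarter_pi_index field_simps)
qed

lemma par_round_orthogonal:
  assumes d: "even d" and \<sigma>: "\<sigma> permutes {..<d}"
  shows "transpose_mat (par_round d \<sigma>) * par_round d \<sigma> = 1\<^sub>m d"
proof (rule eq_matI)
  fix i j assume "i < dim_row (1\<^sub>m d :: real mat)" "j < dim_col (1\<^sub>m d :: real mat)"
  then have ij: "i < d" "j < d" by simp_all
  let ?i = "inv \<sigma> i" and ?j = "inv \<sigma> j"
  have lt: "\<sigma> l < d" if "l < d" for l
    using permutes_in_image[OF \<sigma>, of l] that by simp
  have inv_lt: "?i < d"
    using permutes_in_image[OF permutes_inv[OF \<sigma>], of i] ij by simp
  have iv: "inv \<sigma> (\<sigma> l) = l" for l
    using permutes_inverses(2)[OF \<sigma>] .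
  have "(transpose_mat (par_round d \<sigma>) * par_round d \<sigma>) $$ (i, j)
      = (\<Sum>l<d. par_round d \<sigma> $$ (l, i) * par_round d \<sigma> $$ (l, j))"
    using ij by (simp add: scalar_prod_def par_round_def lessThan_atLeast0)
  also have "\<dots> = (\<Sum>l<d. par_round d \<sigma> $$ (\<sigma> l, i) * par_round d \<sigma> $$ (\<sigma> l, j))"
    by (rule sum.permute[OF \<sigma>, unfolded o_def])
  also have "\<dots> = (\<Sum>l<d. if ?i div 2 = l div 2 then (if ?i div 2 = ?j div 2
      then rot_quarter_pi $$ (l mod 2, ?i mod 2) * rot_quarter_pi $$ (l mod 2, ?j mod 2) else 0) else 0)"
    by (rule sum.cong) (use ij in \<open>auto simp: par_round_def lt iv\<close>)
  also have "\<dots> = (if ?i div 2 = ?j div 2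
      then rot_quarter_pi $$ (0, ?i mod 2) * rot_quarter_pi $$ (0, ?j mod 2)
        + rot_quarter_pi $$ (Suc 0, ?i mod 2) * rot_quarter_pi $$ (Suc 0, ?j mod 2) else 0)"
    by (simp add: sum_over_pair[OF d inv_lt])
  also have "\<dots> = (if ?i = ?j then 1 else 0)"
  proof (cases "?i div 2 = ?j div 2")
    case True
    have "?i = ?j \<longleftrightarrow> ?i mod 2 = ?j mod 2"
      using True by (metis div_mult_mod_eq)
    moreover have "?i mod 2 = 0 \<or> ?i mod 2 = Suc 0" "?j mod 2 = 0 \<or> ?j mod 2 = Suc 0"
      by linarith+
    ultimately show ?thesis
      using True by (auto simp: rot_quarter_pi_index)
  qed auto
  also have "(?i = ?j) = (i = j)"
    using permutes_inverses(1)[OF \<sigma>] by metis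
  finally show "(transpose_mat (par_round d \<sigma>) * par_round d \<sigma>) $$ (i, j) = 1\<^sub>m d $$ (i, j)"
    using ij by simp
qed (simp_all add: par_round_def)

lemma par_walk_orthogonal:
  assumes "even d" "\<And>t. t \<in> {1..T} \<Longrightarrow> \<sigma> t permutes {..<d}"
  shows "par_walk d \<sigma> T \<in> carrier_mat d d
    \<and> transpose_mat (par_walk d \<sigma> T) * par_walk d \<sigma> T = 1\<^sub>m d"
  using assms(2)
proof (induction T)
  case (Suc T)
  let ?R = "par_round d (\<sigma> (Suc T))" and ?Q = "par_walk d \<sigma> T"
  have R: "?R \<in> carrier_mat d d" "transpose_mat ?R * ?R = 1\<^sub>m d"
    using par_round_carrier par_round_orthogonal[OF assms(1)] Suc.prems by auto
  have Q: "?Q \<in> carrier_mat d d" "transpose_mat ?Q * ?Q = 1\<^sub>m d"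
    using Suc by auto
  have "transpose_mat (?R * ?Q) * (?R * ?Q) = (transpose_mat ?Q * transpose_mat ?R) * (?R * ?Q)"
    using R(1) Q(1) by (simp add: transpose_mult)
  also have "\<dots> = transpose_mat ?Q * (transpose_mat ?R * (?R * ?Q))"
    by (rule assoc_mult_mat) (use R(1) Q(1) in auto)
  also have "transpose_mat ?R * (?R * ?Q) = (transpose_mat ?R * ?R) * ?Q"
    by (rule assoc_mult_mat[symmetric]) (use R(1) Q(1) in auto)
  finally show ?case
    using R Q by simp
qed simp

end

theory Submission
  imports Defs "Jordan_Normal_Form.Determinant" "HOL-Real_Asymp.Real_Asymp"
begin

text \<open>Cut the walk as \<open>Q = A R\<^sub>\<sigma> B\<close> with independent factors. An entry of \<open>Q\<close> is the corresponding entry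
  of \<open>A B\<close> (a walk with one round less) divided by \<open>\<surd>2\<close>, plus an antisymmetric sum over the pairs of
  \<open>\<sigma>\<close> in a row of \<open>A\<close> and a column of \<open>B\<close>. Symmetrising over the order within the pairs bounds the
  exponential moment of this sum by a product over the pairs, which behaves as if the pairs were
  independent; so the sum is \<open>O(\<surd>(ln d / d))\<close> with high probability, provided that the entries of \<open>A\<close>
  and \<open>B\<close> are at most \<open>(2 d ln d) powr (-1/4)\<close>. This weak flatness holds after \<open>O(ln d)\<close> rounds, because
  a round roughly halves the expected 24th moment of the entries. Iterating the cut over the last
  \<open>log\<^sub>2 d\<close> rounds makes the factors \<open>1 / \<surd>2\<close> reduce the trivial bound \<open>1\<close> to \<open>1 / \<surd>d\<close>.\<close>

section \<open>Product moments of a uniform permutation\<close>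

text \<open>Composing with the inverse of one fixed extension \<open>\<tau>\<close> of
  \<open>g\<close> injects all extensions into the permutations of \<open>A - L\<close>. If
  \<open>g\<close> has no extension (for example if it is not injective on \<open>L\<close>), the
  set is empty; hence only an inequality.\<close>

lemma card_permutes_extending_le:
  assumes A: "finite A" and L: "L \<subseteq> A"
  shows "card {\<sigma>. \<sigma> permutes A \<and> (\<forall>l\<in>L. \<sigma> l = g l)} \<le> fact (card A - card L)"
proof (cases "\<exists>\<tau>. \<tau> permutes A \<and> (\<forall>l\<in>L. \<tau> l = g l)")
  case True
  then obtain \<tau> where \<tau>: "\<tau> permutes A" "\<forall>l\<in>L. \<tau> l = g l" by blast
  let ?S = "{\<sigma>. \<sigma> permutes A \<and> (\<forall>l\<in>L. \<sigma> l = g l)}"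
  have "inv_into UNIV \<tau> \<circ> \<sigma> permutes A - L" if "\<sigma> \<in> ?S" for \<sigma>
  proof (rule permutes_superset)
    show "inv_into UNIV \<tau> \<circ> \<sigma> permutes A"
      using that \<tau> by (intro permutes_compose permutes_inv) auto
    have "(inv_into UNIV \<tau> \<circ> \<sigma>) l = l" if "l \<in> L" for l
      using \<open>\<sigma> \<in> ?S\<close> that \<tau> permutes_inverses(2)[OF \<tau>(1), of l] by auto
    then show "\<And>x. x \<in> A - (A - L) \<Longrightarrow> (inv_into UNIV \<tau> \<circ> \<sigma>) x = x" by auto
  qed
  moreover have "inj_on (\<lambda>\<sigma>. inv_into UNIV \<tau> \<circ> \<sigma>) ?S"
    using permutes_inverses(1)[OF \<tau>(1)] by (intro inj_onI) (metis comp_apply ext)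
  ultimately have "card ?S \<le> card {\<sigma>. \<sigma> permutes A - L}"
    using A by (intro card_inj_on_le[where f = "\<lambda>\<sigma>. inv_into UNIV \<tau> \<circ> \<sigma>"]) (auto intro: finite_permutations)
  also have "\<dots> = fact (card A - card L)"
    using A L by (intro card_permutations) (auto simp: card_Diff_subset finite_subset)
  finally show ?thesis .
next
  case False
  then have "{\<sigma>. \<sigma> permutes A \<and> (\<forall>l\<in>L. \<sigma> l = g l)} = {}" by blast
  then show ?thesis by (simp only: card.empty zero_le)
qed

text \<open>Group the permutations by their restriction to \<open>L\<close>; each fibre has at most
  \<open>fact (card A - card L)\<close> elements. Letting the restriction range over all functions
  from \<open>L\<close> to \<open>A\<close> only adds nonnegative terms, and then the sum factorises
  as if the values were independent.\<close>

lemma sum_permutes_prod_le: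
  fixes f :: "'a \<Rightarrow> 'a \<Rightarrow> real"
  assumes A: "finite A" and L: "L \<subseteq> A" and f: "\<And>l a. f l a \<ge> 0"
  shows "(\<Sum>\<sigma> | \<sigma> permutes A. \<Prod>l\<in>L. f l (\<sigma> l)) \<le> fact (card A - card L) * (\<Prod>l\<in>L. \<Sum>a\<in>A. f l a)"
proof -
  have fL: "finite L" using A L finite_subset by blast
  let ?P = "{\<sigma>. \<sigma> permutes A}"
  have "(\<Sum>\<sigma>\<in>?P. \<Prod>l\<in>L. f l (\<sigma> l)) = (\<Sum>\<sigma>\<in>?P. \<Prod>l\<in>L. f l (restrict \<sigma> L l))"
    by (intro sum.cong prod.cong) auto
  also have "\<dots> = (\<Sum>g\<in>PiE L (\<lambda>_. A). \<Sum>\<sigma>\<in>{\<sigma>\<in>?P. restrict \<sigma> L = g}. \<Prod>l\<in>L. f l (restrict \<sigma> L l))"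
    using A L fL by (intro sum.group[symmetric])
      (auto intro!: finite_permutations finite_PiE simp: permutes_in_image subset_iff)
  also have "\<dots> = (\<Sum>g\<in>PiE L (\<lambda>_. A). card {\<sigma>\<in>?P. restrict \<sigma> L = g} * (\<Prod>l\<in>L. f l (g l)))"
    by (intro sum.cong) auto
  also have "\<dots> \<le> (\<Sum>g\<in>PiE L (\<lambda>_. A). fact (card A - card L) * (\<Prod>l\<in>L. f l (g l)))"
  proof (intro sum_mono mult_right_mono prod_nonneg ballI f)
    fix g assume g: "g \<in> PiE L (\<lambda>_. A)"
    have "{\<sigma>\<in>?P. restrict \<sigma> L = g} \<subseteq> {\<sigma>. \<sigma> permutes A \<and> (\<forall>l\<in>L. \<sigma> l = g l)}"
      by auto
    then have "card {\<sigma>\<in>?P. restrict \<sigma> L = g} \<le> fact (card A - card L)"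
      using card_permutes_extending_le[OF A L, of g]
        card_mono[of "{\<sigma>. \<sigma> permutes A \<and> (\<forall>l\<in>L. \<sigma> l = g l)}"]
      by (smt (verit) A finite_permutations finite_subset Collect_mono le_trans mem_Collect_eq)
    then show "real (card {\<sigma>\<in>?P. restrict \<sigma> L = g}) \<le> fact (card A - card L)"
      by (metis of_nat_fact of_nat_le_iff)
  qed
  also have "\<dots> = fact (card A - card L) * (\<Prod>l\<in>L. \<Sum>a\<in>A. f l a)"
    using A fL by (subst prod_sum_PiE) (auto simp: sum_distrib_left)
  finally show ?thesis .
qed

text \<open>This is the price of treating \<open>m\<close> values of a uniform permutation as
  independent: a factor e per value. It combines m^m / m! <= e^m, a single term of the exponential
  series, with (d/m)^m <= \<open>d choose m\<close>.\<close>

lemma fact_diff_le: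
  assumes "m \<le> d"
  shows "real d ^ m * fact (d - m) \<le> exp (real m) * fact d"
proof (cases "m = 0")
  case False
  have "real m ^ m / fact m \<le> exp (real m)"
  proof -
    have "summable (\<lambda>k. real m ^ k /\<^sub>R fact k)" by (rule summable_exp_generic)
    then have "sum (\<lambda>k. real m ^ k /\<^sub>R fact k) {m} \<le> (\<Sum>k. real m ^ k /\<^sub>R fact k)"
      by (intro sum_le_suminf) auto
    then show ?thesis by (simp add: exp_def divide_inverse mult.commute)
  qed
  then have 1: "real m ^ m \<le> exp (real m) * fact m" by (simp add: field_simps)
  have "(real d / real m) ^ m \<le> real (d choose m)"
    using assms by (rule binomial_ge_n_over_k_pow_k)
  then have "real d ^ m \<le> real m ^ m * real (d choose m)"
    using False by (simp add: power_divide field_simps)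
  also have "\<dots> \<le> exp (real m) * fact m * real (d choose m)"
    using 1 by (intro mult_right_mono) auto
  finally have "real d ^ m * fact (d - m) \<le> exp (real m) * fact m * real (d choose m) * fact (d - m)"
    by (intro mult_right_mono) auto
  also have "\<dots> = exp (real m) * fact d"
  proof -
    have "fact d = (fact m * fact (d - m) * real (d choose m) :: real)"
      using binomial_fact_lemma[OF assms] by (metis of_nat_fact of_nat_mult)
    then show ?thesis by simp
  qed
  finally show ?thesis .
qed simp

section \<open>Products over the random pairs and the exponential moment of the fluctuation\<close>

lemma prod_pairs:
  fixes g :: "nat \<Rightarrow> 'b :: comm_monoid_mult"
  assumes "finite S"
  shows "(\<Prod>l\<in>{l. l div 2 \<in> S}. g l) = (\<Prod>k\<in>S. g (2 * k) * g (2 * k + 1))"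
    and "card {l. l div 2 \<in> S} = 2 * card S"
proof -
  have eq: "{l. l div 2 \<in> S} = (\<lambda>k. 2 * k) ` S \<union> (\<lambda>k. 2 * k + 1) ` S"
  proof (intro Set.set_eqI iffI)
    fix l assume "l \<in> {l. l div 2 \<in> S}"
    moreover have "l = 2 * (l div 2) \<or> l = 2 * (l div 2) + 1" by presburger
    ultimately show "l \<in> (\<lambda>k. 2 * k) ` S \<union> (\<lambda>k. 2 * k + 1) ` S" by blast
  qed auto
  have disj: "(\<lambda>k. 2 * k) ` S \<inter> (\<lambda>k. 2 * k + 1) ` S = {}"
    by auto presburger
  show "(\<Prod>l\<in>{l. l div 2 \<in> S}. g l) = (\<Prod>k\<in>S. g (2 * k) * g (2 * k + 1))"
    unfolding eq using assms disj
    by (subst prod.union_disjoint) (auto simp: prod.reindex inj_on_def prod.distrib o_def)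
  show "card {l. l div 2 \<in> S} = 2 * card S"
    unfolding eq using assms disj
    by (subst card_Un_disjoint) (auto simp: card_image inj_on_def)
qed

lemma sum_permutes_pairs_le:
  fixes p q :: "nat \<Rightarrow> real"
  assumes S: "S \<subseteq> {..<n}" and p: "\<And>a. p a \<ge> 0" and q: "\<And>a. q a \<ge> 0"
  shows "(\<Sum>\<sigma> | \<sigma> permutes {..<2 * n}. \<Prod>k\<in>S. p (\<sigma> (2 * k)) * q (\<sigma> (2 * k + 1)))
    \<le> fact (2 * n - 2 * card S) * ((\<Sum>a<2 * n. p a) * (\<Sum>a<2 * n. q a)) ^ card S"
proof -
  have fS: "finite S" using S finite_subset by blast
  define f where "f = (\<lambda>l::nat. if even l then p else q)"
  let ?L = "{l. l div 2 \<in> S}"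
  have "(\<Sum>\<sigma> | \<sigma> permutes {..<2 * n}. \<Prod>k\<in>S. p (\<sigma> (2 * k)) * q (\<sigma> (2 * k + 1)))
      = (\<Sum>\<sigma> | \<sigma> permutes {..<2 * n}. \<Prod>l\<in>?L. f l (\<sigma> l))"
    by (subst prod_pairs(1)[OF fS]) (simp add: f_def)
  also have "\<dots> \<le> fact (card {..<2 * n} - card ?L) * (\<Prod>l\<in>?L. \<Sum>a<2 * n. f l a)"
    using S p q by (intro sum_permutes_prod_le) (auto simp: f_def)
  also have "(\<Prod>l\<in>?L. \<Sum>a<2 * n. f l a) = ((\<Sum>a<2 * n. p a) * (\<Sum>a<2 * n. q a)) ^ card S"
    by (subst prod_pairs(1)[OF fS]) (simp add: f_def)
  finally show ?thesis
    using prod_pairs(2)[OF fS] by simp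
qed

text \<open>Expand the product over the subsets \<open>S\<close> of the pairs. By
  \<open>fact_diff_le\<close> with m = 2 |S|, each chosen pair costs at most e^2 / (2n)^2, so the
  sum over \<open>S\<close> folds back into (1 + c e^2 / (4 n^2))^n. The constant 9 bounds
  e^2.\<close>

lemma sum_permutes_prod_one_plus_le:
  fixes p q :: "nat \<Rightarrow> real"
  assumes n: "n > 0" and c: "c \<ge> 0" and p: "\<And>a. p a \<ge> 0" and q: "\<And>a. q a \<ge> 0"
    and p1: "(\<Sum>a<2 * n. p a) = 1" and q1: "(\<Sum>a<2 * n. q a) = 1"
  shows "(\<Sum>\<sigma> | \<sigma> permutes {..<2 * n}. \<Prod>k<n. 1 + c * (p (\<sigma> (2 * k)) * q (\<sigma> (2 * k + 1))))
    \<le> fact (2 * n) * exp (9 * c / (4 * real n))"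
proof -
  let ?P = "{\<sigma>. \<sigma> permutes {..<2 * n}}"
  let ?e = "exp 2 / (4 * (real n)\<^sup>2)"
  have "(\<Sum>\<sigma>\<in>?P. \<Prod>k<n. 1 + c * (p (\<sigma> (2 * k)) * q (\<sigma> (2 * k + 1))))
    = (\<Sum>\<sigma>\<in>?P. \<Sum>S\<in>Pow {..<n}. c ^ card S * (\<Prod>k\<in>S. p (\<sigma> (2 * k)) * q (\<sigma> (2 * k + 1))))"
    by (subst add.commute, subst prod_add) (simp_all add: prod.distrib)
  also have "\<dots> = (\<Sum>S\<in>Pow {..<n}. c ^ card S * (\<Sum>\<sigma>\<in>?P. \<Prod>k\<in>S. p (\<sigma> (2 * k)) * q (\<sigma> (2 * k + 1))))"
    by (subst sum.swap) (simp add: sum_distrib_left)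
  also have "\<dots> \<le> (\<Sum>S\<in>Pow {..<n}. c ^ card S * (fact (2 * n) * ?e ^ card S))"
  proof (intro sum_mono mult_left_mono)
    fix S assume S: "S \<in> Pow {..<n}"
    then have "card S \<le> n" using card_mono[of "{..<n}" S] by auto
    then have "real (2 * n) ^ (2 * card S) * fact (2 * n - 2 * card S) \<le> exp (real (2 * card S)) * fact (2 * n)"
      by (intro fact_diff_le) auto
    also have "exp (real (2 * card S)) = exp 2 ^ card S"
      by (simp add: mult.commute flip: exp_of_nat_mult)
    finally have "(4 * (real n)\<^sup>2) ^ card S * fact (2 * n - 2 * card S) \<le> exp 2 ^ card S * fact (2 * n)"
      by (simp add: power_mult power_mult_distrib)
    then have "fact (2 * n - 2 * card S) \<le> fact (2 * n) * ?e ^ card S"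
      using n by (simp add: power_divide field_simps)
    then show "(\<Sum>\<sigma>\<in>?P. \<Prod>k\<in>S. p (\<sigma> (2 * k)) * q (\<sigma> (2 * k + 1))) \<le> fact (2 * n) * ?e ^ card S"
      using sum_permutes_pairs_le[of S n p q] S p q p1 q1 by auto
  qed (use c in auto)
  also have "\<dots> = fact (2 * n) * (\<Prod>k<n. c * ?e + 1)"
    by (subst prod_add) (simp_all add: sum_distrib_left power_mult_distrib mult_ac power_divide)
  also have "\<dots> = fact (2 * n) * (1 + c * ?e) ^ n" by (simp add: add.commute)
  also have "\<dots> \<le> fact (2 * n) * exp (c * ?e) ^ n"
    using c by (intro mult_left_mono power_mono) (auto intro: exp_ge_add_one_self add_nonneg_nonneg)
  also have "exp (c * ?e) ^ n = exp (exp 2 * c / (4 * real n))"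
    using n by (simp add: power2_eq_square field_simps flip: exp_of_nat_mult)
  also have "\<dots> \<le> exp (9 * c / (4 * real n))"
  proof -
    have "exp 2 = exp (1::real) * exp 1" by (simp flip: exp_add)
    also have "\<dots> \<le> 3 * 3" using exp_le by (intro mult_mono) auto
    finally show ?thesis using c by (auto intro!: divide_right_mono mult_right_mono)
  qed
  finally show ?thesis by simp
qed

text \<open>Exchanging the two positions of the pairs in \<open>F\<close> preserves the uniform distribution; averaging
  over all \<open>F\<close> turns the exponential of the sum into a product of hyperbolic cosines.\<close>

lemma sum_permutes_exp_antisym:
  fixes w :: "nat \<Rightarrow> nat \<Rightarrow> real"
  assumes w: "\<And>a b. w b a = - w a b"
  shows "(\<Sum>\<sigma> | \<sigma> permutes {..<2 * n}. exp (\<Sum>k<n. w (\<sigma> (2 * k)) (\<sigma> (2 * k + 1))))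
    = (\<Sum>\<sigma> | \<sigma> permutes {..<2 * n}. \<Prod>k<n. cosh (w (\<sigma> (2 * k)) (\<sigma> (2 * k + 1))))"
proof -
  let ?P = "{\<sigma>. \<sigma> permutes {..<2 * n}}"
  let ?w = "\<lambda>\<sigma> k. w (\<sigma> (2 * k)) (\<sigma> (2 * k + 1))"
  define \<tau> where "\<tau> = (\<lambda>F (l::nat). if l div 2 \<in> F then (if even l then l + 1 else l - 1) else l)"
  have \<tau>: "\<tau> F permutes {..<2 * n}" if F: "F \<subseteq> {..<n}" for F
  proof (rule bij_imp_permutes)
    have inv: "\<tau> F (\<tau> F l) = l" for l
      by (auto simp: \<tau>_def elim!: oddE evenE)
    have into: "\<tau> F l < 2 * n" if "l < 2 * n" for l
      using that F by (auto simp: \<tau>_def elim!: oddE evenE)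
    show "bij_betw (\<tau> F) {..<2 * n} {..<2 * n}"
      by (rule bij_betwI[where g = "\<tau> F"]) (auto simp: inv into)
    show "\<tau> F l = l" if "l \<notin> {..<2 * n}" for l
      using that F by (auto simp: \<tau>_def)
  qed
  have sgn: "(\<Sum>\<sigma>\<in>?P. exp (\<Sum>k<n. ?w \<sigma> k)) =
    (\<Sum>\<sigma>\<in>?P. (\<Prod>k\<in>F. exp (- ?w \<sigma> k)) * (\<Prod>k\<in>{..<n} - F. exp (?w \<sigma> k)))" if F: "F \<in> Pow {..<n}" for F
  proof -
    have "(\<Sum>\<sigma>\<in>?P. exp (\<Sum>k<n. ?w \<sigma> k)) = (\<Sum>\<sigma>\<in>?P. exp (\<Sum>k<n. ?w (\<sigma> \<circ> \<tau> F) k))"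
      using F by (intro sum_permutations_compose_right \<tau>) auto
    also have "\<dots> = (\<Sum>\<sigma>\<in>?P. \<Prod>k<n. exp (if k \<in> F then - ?w \<sigma> k else ?w \<sigma> k))"
      unfolding exp_sum[OF finite_lessThan]
      by (intro sum.cong prod.cong refl arg_cong[where f = exp]) (auto simp: \<tau>_def intro: w)
    also have "\<dots> = (\<Sum>\<sigma>\<in>?P. (\<Prod>k\<in>F. exp (- ?w \<sigma> k)) * (\<Prod>k\<in>{..<n} - F. exp (?w \<sigma> k)))"
    proof (intro sum.cong refl)
      fix \<sigma>
      have "(\<Prod>k<n. exp (if k \<in> F then - ?w \<sigma> k else ?w \<sigma> k)) =
        (\<Prod>k\<in>{..<n} - F. exp (if k \<in> F then - ?w \<sigma> k else ?w \<sigma> k)) * (\<Prod>k\<in>F. exp (if k \<in> F then - ?w \<sigma> k else ?w \<sigma> k))"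
        using F by (intro prod.subset_diff) auto
      then show "(\<Prod>k<n. exp (if k \<in> F then - ?w \<sigma> k else ?w \<sigma> k)) =
        (\<Prod>k\<in>F. exp (- ?w \<sigma> k)) * (\<Prod>k\<in>{..<n} - F. exp (?w \<sigma> k))"
        by (simp add: mult.commute)
    qed
    finally show ?thesis .
  qed
  have "2 ^ n * (\<Sum>\<sigma>\<in>?P. exp (\<Sum>k<n. ?w \<sigma> k)) = (\<Sum>F\<in>Pow {..<n}. \<Sum>\<sigma>\<in>?P. exp (\<Sum>k<n. ?w \<sigma> k))"
    by (simp add: card_Pow)
  also have "\<dots> = (\<Sum>\<sigma>\<in>?P. \<Sum>F\<in>Pow {..<n}. (\<Prod>k\<in>F. exp (- ?w \<sigma> k)) * (\<Prod>k\<in>{..<n} - F. exp (?w \<sigma> k)))"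
    by (subst sum.swap) (intro sum.cong refl sgn)
  also have "\<dots> = (\<Sum>\<sigma>\<in>?P. \<Prod>k<n. exp (- ?w \<sigma> k) + exp (?w \<sigma> k))"
    by (subst prod_add) auto
  also have "\<dots> = (\<Sum>\<sigma>\<in>?P. \<Prod>k<n. 2 * cosh (?w \<sigma> k))"
    by (intro sum.cong prod.cong) (simp_all add: cosh_field_def)
  also have "\<dots> = 2 ^ n * (\<Sum>\<sigma>\<in>?P. \<Prod>k<n. cosh (?w \<sigma> k))"
    by (simp add: prod.distrib sum_distrib_left)
  finally show ?thesis by simp
qed

text \<open>For 0 <= y <= 1, average exp y <= 1 + y + y^2 and exp (-y) <= 1 / (1 + y) <= 1 - y +
  y^2; the linear terms cancel. Negative arguments follow by symmetry.\<close>

lemma cosh_le_one_plus_square: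
  fixes x :: real
  assumes "\<bar>x\<bar> \<le> 1"
  shows "cosh x \<le> 1 + x\<^sup>2"
proof -
  have main: "cosh y \<le> 1 + y\<^sup>2" if y: "0 \<le> y" "y \<le> 1" for y :: real
  proof -
    have "exp (- y) \<le> 1 / (1 + y)"
      using exp_ge_add_one_self[of y] y by (simp add: exp_minus field_simps)
    also have "\<dots> \<le> 1 - y + y\<^sup>2"
    proof -
      have "(1 - y + y\<^sup>2) * (1 + y) = 1 + y ^ 3"
        by (simp add: algebra_simps power2_eq_square power3_eq_cube)
      then have "1 \<le> (1 - y + y\<^sup>2) * (1 + y)" using y by simp
      then show ?thesis using y by (simp add: pos_divide_le_eq)
    qed
    finally show ?thesis using exp_bound[OF y] by (simp add: cosh_field_def)
  qed
  show ?thesis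
    using main[of x] main[of "- x"] assms by (cases "x \<ge> 0") auto
qed

text \<open>The fluctuation of the entry \<open>u\<^sup>T R\<^sub>\<sigma> v\<close> around \<open>(u \<bullet> v) / \<surd>2\<close>.\<close>

definition cross_sum :: "nat \<Rightarrow> (nat \<Rightarrow> real) \<Rightarrow> (nat \<Rightarrow> real) \<Rightarrow> (nat \<Rightarrow> nat) \<Rightarrow> real" where
  "cross_sum n u v \<sigma> =
    (\<Sum>k<n. u (\<sigma> (2 * k + 1)) * v (\<sigma> (2 * k)) - u (\<sigma> (2 * k)) * v (\<sigma> (2 * k + 1))) / sqrt 2"

text \<open>After symmetrisation each pair contributes the cosh of an antisymmetric weight, which is
  at most (1 + X)(1 + Y), where X and Y carry the squared products for the two orders of the pair.
  The condition on \<open>l\<close> keeps X and Y below 1/2, so that cosh is only evaluated on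
  [-1, 1].\<close>

lemma sum_permutes_exp_cross_sum_le:
  fixes u v :: "nat \<Rightarrow> real" and l :: real
  assumes n: "n > 0"
    and u1: "(\<Sum>a<2 * n. (u a)\<^sup>2) = 1" and v1: "(\<Sum>a<2 * n. (v a)\<^sup>2) = 1"
    and u: "\<And>a. a < 2 * n \<Longrightarrow> (u a)\<^sup>2 \<le> \<epsilon>" and v: "\<And>a. a < 2 * n \<Longrightarrow> (v a)\<^sup>2 \<le> \<epsilon>"
    and l: "2 * l\<^sup>2 * \<epsilon>\<^sup>2 \<le> 1"
  shows "(\<Sum>\<sigma> | \<sigma> permutes {..<2 * n}. exp (l * cross_sum n u v \<sigma>)) \<le> fact (2 * n) * exp (7 * l\<^sup>2 / real n)"
proof -
  let ?P = "{\<sigma>. \<sigma> permutes {..<2 * n}}"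
  let ?p = "\<lambda>a. (v a)\<^sup>2" and ?q = "\<lambda>a. (u a)\<^sup>2"
  define w where "w = (\<lambda>a b. l * (u b * v a - u a * v b) / sqrt 2)"
  let ?X = "\<lambda>\<sigma> k. l\<^sup>2 * (?p (\<sigma> (2 * k)) * ?q (\<sigma> (2 * k + 1)))"
  let ?Y = "\<lambda>\<sigma> k. l\<^sup>2 * (?q (\<sigma> (2 * k)) * ?p (\<sigma> (2 * k + 1)))"
  have "(\<Sum>\<sigma>\<in>?P. exp (l * cross_sum n u v \<sigma>)) = (\<Sum>\<sigma>\<in>?P. exp (\<Sum>k<n. w (\<sigma> (2 * k)) (\<sigma> (2 * k + 1))))"
    by (intro sum.cong refl arg_cong[where f = exp])
      (simp add: cross_sum_def w_def sum_distrib_left flip: sum_divide_distrib)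
  also have "\<dots> = (\<Sum>\<sigma>\<in>?P. \<Prod>k<n. cosh (w (\<sigma> (2 * k)) (\<sigma> (2 * k + 1))))"
    by (rule sum_permutes_exp_antisym) (simp add: w_def field_simps)
  also have "\<dots> \<le> (\<Sum>\<sigma>\<in>?P. ((\<Prod>k<n. 1 + 3 * ?X \<sigma> k) + (\<Prod>k<n. 1 + 3 * ?Y \<sigma> k)) / 2)"
  proof (rule sum_mono)
    fix \<sigma> assume "\<sigma> \<in> ?P"
    then have \<sigma>: "\<sigma> permutes {..<2 * n}" by simp
    have small: "l\<^sup>2 * (?p a * ?q b) \<le> 1 / 2" if "a < 2 * n" "b < 2 * n" for a b
    proof -
      have "?p a * ?q b \<le> \<epsilon> * \<epsilon>"
        using that u v by (intro mult_mono) (auto intro: order_trans[OF zero_le_power2])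
      then have "l\<^sup>2 * (?p a * ?q b) \<le> l\<^sup>2 * \<epsilon>\<^sup>2"
        by (intro mult_left_mono) (auto simp: power2_eq_square)
      with l show ?thesis by simp
    qed
    have lt: "\<sigma> (2 * k) < 2 * n" "\<sigma> (2 * k + 1) < 2 * n" if "k < n" for k
      using permutes_in_image[OF \<sigma>, of "2 * k"] permutes_in_image[OF \<sigma>, of "2 * k + 1"] that by auto
    have XY: "0 \<le> ?X \<sigma> k" "?X \<sigma> k \<le> 1 / 2" "0 \<le> ?Y \<sigma> k" "?Y \<sigma> k \<le> 1 / 2" if "k < n" for k
      using small[OF lt[OF that]] small[OF lt(2)[OF that] lt(1)[OF that]] by (auto simp: mult.commute)
    have cosh: "cosh (w (\<sigma> (2 * k)) (\<sigma> (2 * k + 1))) \<le> (1 + ?X \<sigma> k) * (1 + ?Y \<sigma> k)" if k: "k < n" for k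
    proof -
      define a b where "a = \<sigma> (2 * k)" and "b = \<sigma> (2 * k + 1)"
      have "(w a b)\<^sup>2 = l\<^sup>2 * (u b * v a - u a * v b)\<^sup>2 / 2"
        by (simp add: w_def power_mult_distrib power_divide)
      also have "\<dots> \<le> l\<^sup>2 * (2 * ((u b * v a)\<^sup>2 + (u a * v b)\<^sup>2)) / 2"
        using sum_squares_bound[of "u b * v a" "- (u a * v b)"]
        by (intro divide_right_mono mult_left_mono) (auto simp: power2_diff)
      finally have wb: "(w a b)\<^sup>2 \<le> ?X \<sigma> k + ?Y \<sigma> k"
        by (simp add: a_def b_def power_mult_distrib algebra_simps)
      with XY[OF k] have "(w a b)\<^sup>2 \<le> 1" by linarith
      then have "cosh (w a b) \<le> 1 + (w a b)\<^sup>2"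
        by (intro cosh_le_one_plus_square) (simp add: abs_square_le_1)
      also have "\<dots> \<le> (1 + ?X \<sigma> k) * (1 + ?Y \<sigma> k)"
        using wb mult_nonneg_nonneg[OF XY(1)[OF k] XY(3)[OF k]]
        unfolding distrib_left distrib_right by linarith
      finally show ?thesis by (simp add: a_def b_def)
    qed
    \<comment> \<open>This linearises the squares that the separation of X and Y produces, using x^2
      <= x / 2.\<close>
    have sq: "(1 + x)\<^sup>2 \<le> 1 + 3 * x" if "0 \<le> x" "x \<le> 1 / 2" for x :: real
      using mult_left_mono[OF that(2) that(1)] that by (simp add: power2_eq_square algebra_simps)
    have "(\<Prod>k<n. cosh (w (\<sigma> (2 * k)) (\<sigma> (2 * k + 1)))) \<le> (\<Prod>k<n. (1 + ?X \<sigma> k) * (1 + ?Y \<sigma> k))"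
      using cosh cosh_real_ge_1 by (intro prod_mono) (auto intro: order_trans[OF zero_le_one])
    also have "\<dots> = (\<Prod>k<n. 1 + ?X \<sigma> k) * (\<Prod>k<n. 1 + ?Y \<sigma> k)" by (simp add: prod.distrib)
    \<comment> \<open>X and Y live on the same positions, so their joint product does not have the
      form p times q treated by \<open>sum_permutes_prod_one_plus_le\<close>. The inequality 2 a b
      <= a^2 + b^2 separates them.\<close>
    also have "\<dots> \<le> ((\<Prod>k<n. 1 + ?X \<sigma> k)\<^sup>2 + (\<Prod>k<n. 1 + ?Y \<sigma> k)\<^sup>2) / 2"
      using sum_squares_bound[of "\<Prod>k<n. 1 + ?X \<sigma> k" "\<Prod>k<n. 1 + ?Y \<sigma> k"] by simp
    also have "\<dots> = ((\<Prod>k<n. (1 + ?X \<sigma> k)\<^sup>2) + (\<Prod>k<n. (1 + ?Y \<sigma> k)\<^sup>2)) / 2"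
      by (simp add: prod_power_distrib)
    also have "\<dots> \<le> ((\<Prod>k<n. 1 + 3 * ?X \<sigma> k) + (\<Prod>k<n. 1 + 3 * ?Y \<sigma> k)) / 2"
      using XY by (intro divide_right_mono add_mono prod_mono conjI sq) auto
    finally show "(\<Prod>k<n. cosh (w (\<sigma> (2 * k)) (\<sigma> (2 * k + 1))))
      \<le> ((\<Prod>k<n. 1 + 3 * ?X \<sigma> k) + (\<Prod>k<n. 1 + 3 * ?Y \<sigma> k)) / 2" .
  qed
  also have "\<dots> = ((\<Sum>\<sigma>\<in>?P. \<Prod>k<n. 1 + (3 * l\<^sup>2) * (?p (\<sigma> (2 * k)) * ?q (\<sigma> (2 * k + 1))))
      + (\<Sum>\<sigma>\<in>?P. \<Prod>k<n. 1 + (3 * l\<^sup>2) * (?q (\<sigma> (2 * k)) * ?p (\<sigma> (2 * k + 1))))) / 2"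
    by (simp add: sum.distrib mult.assoc flip: sum_divide_distrib)
  also have "\<dots> \<le> (fact (2 * n) * exp (9 * (3 * l\<^sup>2) / (4 * real n)) + fact (2 * n) * exp (9 * (3 * l\<^sup>2) / (4 * real n))) / 2"
    using n u1 v1 by (intro divide_right_mono add_mono sum_permutes_prod_one_plus_le) auto
  \<comment> \<open>The constant 7 rounds up 27/4.\<close>
  also have "\<dots> \<le> fact (2 * n) * exp (7 * l\<^sup>2 / real n)"
    using n by (simp add: field_simps)
  finally show ?thesis .
qed

section \<open>One round roughly halves the 24th moment\<close>

text \<open>If \<open>y\<close> is at most x / 8, then (9/8)^24 <= 2^9 already gives the factor 1/8,
  and no mixed term is required. Otherwise \<open>x\<close> < 8 \<open>y\<close>, so (2x)^24 can be
  charged to the mixed term: 2^24 * 8^2 / 2^12 = 2^18.\<close>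

lemma add_power_24_le:
  fixes x y :: real
  assumes y: "0 \<le> y" and yx: "y \<le> x"
  shows "(x + y) ^ 24 / 2 ^ 12 \<le> (x\<^sup>2) ^ 12 / 8 + 2 ^ 18 * ((x\<^sup>2) ^ 11 * y\<^sup>2)"
proof (cases "8 * y \<le> x")
  case True
  have "(x + y) ^ 24 \<le> (9 / 8 * x) ^ 24"
    using True y yx by (intro power_mono) auto
  also have "\<dots> = (9 / 8) ^ 24 * (x\<^sup>2) ^ 12"
    by (simp only: power_mult_distrib flip: power_mult) simp
  also have "\<dots> \<le> 2 ^ 9 * (x\<^sup>2) ^ 12"
    by (intro mult_right_mono) (simp_all add: power_divide)
  finally have "(x + y) ^ 24 / 2 ^ 12 \<le> (x\<^sup>2) ^ 12 / 8" by simp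
  moreover have "0 \<le> 2 ^ 18 * ((x\<^sup>2) ^ 11 * y\<^sup>2)" by simp
  ultimately show ?thesis by linarith
next
  case False
  have "(x + y) ^ 24 \<le> (2 * x) ^ 24"
    using y yx by (intro power_mono) auto
  also have "\<dots> = 2 ^ 24 * ((x\<^sup>2) ^ 11 * x\<^sup>2)"
    by (simp only: power_mult_distrib flip: power_mult power_add) simp
  also have "\<dots> \<le> 2 ^ 24 * ((x\<^sup>2) ^ 11 * (8 * y)\<^sup>2)"
    using False y yx by (intro mult_left_mono power_mono) auto
  finally have "(x + y) ^ 24 / 2 ^ 12 \<le> 2 ^ 18 * ((x\<^sup>2) ^ 11 * y\<^sup>2)"
    by (simp add: power_mult_distrib)
  moreover have "0 \<le> (x\<^sup>2) ^ 12" by simp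
  ultimately show ?thesis by linarith
qed

text \<open>Both rotated coordinates are bounded by (|a| + |b|) / sqrt 2, and
  \<open>add_power_24_le\<close> applies with the larger of |a| and |b| in the role of
  \<open>x\<close>. Unless the two are comparable, the 24th powers shrink; comparable entries are
  paid for by the mixed terms, which a random pairing makes small.\<close>

lemma sum_diff_power_24_le:
  fixes a b :: real
  shows "((a - b) / sqrt 2) ^ 24 + ((a + b) / sqrt 2) ^ 24
    \<le> ((a\<^sup>2) ^ 12 + (b\<^sup>2) ^ 12) / 4 + 2 ^ 19 * ((a\<^sup>2) ^ 11 * b\<^sup>2 + a\<^sup>2 * (b\<^sup>2) ^ 11)"
proof -
  have *: "(z / sqrt 2) ^ 24 \<le> ((a\<^sup>2) ^ 12 + (b\<^sup>2) ^ 12) / 8 + 2 ^ 18 * ((a\<^sup>2) ^ 11 * b\<^sup>2 + a\<^sup>2 * (b\<^sup>2) ^ 11)"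
    if z: "\<bar>z\<bar> \<le> \<bar>a\<bar> + \<bar>b\<bar>" for z
  proof -
    have "(z / sqrt 2) ^ 24 = \<bar>z\<bar> ^ 24 / ((sqrt 2)\<^sup>2) ^ 12"
      by (simp only: power_divide flip: power_mult) (simp add: power_even_abs)
    also have "\<dots> = \<bar>z\<bar> ^ 24 / 2 ^ 12" by simp
    also have "\<dots> \<le> (\<bar>a\<bar> + \<bar>b\<bar>) ^ 24 / 2 ^ 12"
      using z by (intro divide_right_mono power_mono) auto
    also have "\<dots> \<le> ((a\<^sup>2) ^ 12 + (b\<^sup>2) ^ 12) / 8 + 2 ^ 18 * ((a\<^sup>2) ^ 11 * b\<^sup>2 + a\<^sup>2 * (b\<^sup>2) ^ 11)"
    proof -
      have nn: "0 \<le> (a\<^sup>2) ^ 12" "0 \<le> (b\<^sup>2) ^ 12" 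
        "0 \<le> 2 ^ 18 * ((a\<^sup>2) ^ 11 * b\<^sup>2)" "0 \<le> 2 ^ 18 * (a\<^sup>2 * (b\<^sup>2) ^ 11)" by simp_all
      have "\<bar>b\<bar> \<le> \<bar>a\<bar> \<or> \<bar>a\<bar> \<le> \<bar>b\<bar>" by linarith
      then have "(\<bar>a\<bar> + \<bar>b\<bar>) ^ 24 / 2 ^ 12 \<le> (a\<^sup>2) ^ 12 / 8 + 2 ^ 18 * ((a\<^sup>2) ^ 11 * b\<^sup>2)
        \<or> (\<bar>a\<bar> + \<bar>b\<bar>) ^ 24 / 2 ^ 12 \<le> (b\<^sup>2) ^ 12 / 8 + 2 ^ 18 * (a\<^sup>2 * (b\<^sup>2) ^ 11)"
        using add_power_24_le[of "\<bar>b\<bar>" "\<bar>a\<bar>"] add_power_24_le[of "\<bar>a\<bar>" "\<bar>b\<bar>"]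
        by (auto simp only: power2_abs add.commute mult.commute abs_ge_zero)
      with nn show ?thesis unfolding distrib_left add_divide_distrib by linarith
    qed
    finally show ?thesis .
  qed
  have "\<bar>a - b\<bar> \<le> \<bar>a\<bar> + \<bar>b\<bar>" "\<bar>a + b\<bar> \<le> \<bar>a\<bar> + \<bar>b\<bar>" by linarith+
  note add_mono[OF this[THEN *]]
  also have "(X / 8 + 2 ^ 18 * Y) + (X / 8 + 2 ^ 18 * Y) = X / 4 + 2 ^ 19 * Y" for X Y :: real
    by simp
  finally show ?thesis .
qed

lemma sum_lessThan_double:
  fixes f :: "nat \<Rightarrow> 'b :: comm_monoid_add"
  shows "(\<Sum>i<2 * n. f i) = (\<Sum>k<n. f (2 * k) + f (2 * k + 1))"
  by (induction n) (auto simp: add_ac)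

text \<open>Each of the \<open>n\<close> pairs is the singleton case of
  \<open>sum_permutes_pairs_le\<close>, and n (2n - 2)! <= (2n - 1)! = (2n)! / (2n).\<close>

lemma sum_permutes_pair_le:
  fixes p q :: "nat \<Rightarrow> real"
  assumes p: "\<And>a. p a \<ge> 0" and q: "\<And>a. q a \<ge> 0"
  shows "(\<Sum>\<sigma> | \<sigma> permutes {..<2 * n}. \<Sum>k<n. p (\<sigma> (2 * k)) * q (\<sigma> (2 * k + 1)))
    \<le> fact (2 * n) * ((\<Sum>a<2 * n. p a) * (\<Sum>a<2 * n. q a)) / real (2 * n)"
proof (cases "n = 0")
  case False
  let ?s = "(\<Sum>a<2 * n. p a) * (\<Sum>a<2 * n. q a)"
  have s: "0 \<le> ?s" using p q by (intro mult_nonneg_nonneg sum_nonneg) auto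
  have "(\<Sum>\<sigma> | \<sigma> permutes {..<2 * n}. \<Sum>k<n. p (\<sigma> (2 * k)) * q (\<sigma> (2 * k + 1)))
      = (\<Sum>k<n. \<Sum>\<sigma> | \<sigma> permutes {..<2 * n}. p (\<sigma> (2 * k)) * q (\<sigma> (2 * k + 1)))"
    by (rule sum.swap)
  also have "\<dots> \<le> (\<Sum>k<n. fact (2 * n - 2) * ?s)"
  proof (rule sum_mono)
    fix k assume "k \<in> {..<n}"
    then show "(\<Sum>\<sigma> | \<sigma> permutes {..<2 * n}. p (\<sigma> (2 * k)) * q (\<sigma> (2 * k + 1))) \<le> fact (2 * n - 2) * ?s"
      using sum_permutes_pairs_le[of "{k}" n p q] p q by simp
  qed
  also have "\<dots> = (real n * fact (2 * n - 2)) * ?s" by simp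
  also have "\<dots> \<le> (fact (2 * n) / real (2 * n)) * ?s"
  proof (rule mult_right_mono[OF _ s])
    obtain m where m: "n = Suc m" using False by (cases n) auto
    have "2 * n = Suc (Suc (2 * m))" using m by simp
    then have "fact (2 * n) = (2 * real m + 2) * ((2 * real m + 1) * fact (2 * n - 2))"
      by (simp add: algebra_simps)
    then have "fact (2 * n) / real (2 * n) = (2 * real m + 1) * fact (2 * n - 2)"
      by (simp add: m divide_simps)
    then show "real n * fact (2 * n - 2) \<le> fact (2 * n) / real (2 * n)"
      by (simp add: m)
  qed
  finally show ?thesis by simp
qed simp

lemma sum_par_round_power_24_le:
  assumes \<sigma>: "\<sigma> permutes {..<2 * n}" and x: "x \<in> carrier_vec (2 * n)"
  shows "(\<Sum>i<2 * n. ((par_round (2 * n) \<sigma> *\<^sub>v x) $ i) ^ 24)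
    \<le> (\<Sum>i<2 * n. (x $ i) ^ 24) / 4
      + 2 ^ 19 * ((\<Sum>k<n. ((x $ \<sigma> (2 * k))\<^sup>2) ^ 11 * (x $ \<sigma> (2 * k + 1))\<^sup>2)
        + (\<Sum>k<n. (x $ \<sigma> (2 * k))\<^sup>2 * ((x $ \<sigma> (2 * k + 1))\<^sup>2) ^ 11))"
proof -
  let ?y = "par_round (2 * n) \<sigma> *\<^sub>v x"
  have "(\<Sum>i<2 * n. (?y $ i) ^ 24) = (\<Sum>i<2 * n. (?y $ \<sigma> i) ^ 24)"
    by (rule sum.permute[OF \<sigma>, unfolded o_def])
  also have "\<dots> = (\<Sum>k<n. (?y $ \<sigma> (2 * k)) ^ 24 + (?y $ \<sigma> (2 * k + 1)) ^ 24)"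
    by (rule sum_lessThan_double)
  also have "\<dots> = (\<Sum>k<n. ((x $ \<sigma> (2 * k) - x $ \<sigma> (2 * k + 1)) / sqrt 2) ^ 24
      + ((x $ \<sigma> (2 * k) + x $ \<sigma> (2 * k + 1)) / sqrt 2) ^ 24)"
  proof (rule sum.cong[OF refl])
    fix k assume "k \<in> {..<n}"
    then have k: "2 * k < 2 * n" by simp
    have e: "even (2 * n)" by simp
    show "(?y $ \<sigma> (2 * k)) ^ 24 + (?y $ \<sigma> (2 * k + 1)) ^ 24
      = ((x $ \<sigma> (2 * k) - x $ \<sigma> (2 * k + 1)) / sqrt 2) ^ 24 + ((x $ \<sigma> (2 * k) + x $ \<sigma> (2 * k + 1)) / sqrt 2) ^ 24"
      unfolding par_round_action[OF e \<sigma> k x] ..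
  qed
  also have "\<dots> \<le> (\<Sum>k<n. (((x $ \<sigma> (2 * k))\<^sup>2) ^ 12 + ((x $ \<sigma> (2 * k + 1))\<^sup>2) ^ 12) / 4
      + 2 ^ 19 * (((x $ \<sigma> (2 * k))\<^sup>2) ^ 11 * (x $ \<sigma> (2 * k + 1))\<^sup>2 + (x $ \<sigma> (2 * k))\<^sup>2 * ((x $ \<sigma> (2 * k + 1))\<^sup>2) ^ 11))"
    by (intro sum_mono sum_diff_power_24_le)
  also have "\<dots> = (\<Sum>k<n. (((x $ \<sigma> (2 * k))\<^sup>2) ^ 12 + ((x $ \<sigma> (2 * k + 1))\<^sup>2) ^ 12)) / 4
      + 2 ^ 19 * ((\<Sum>k<n. ((x $ \<sigma> (2 * k))\<^sup>2) ^ 11 * (x $ \<sigma> (2 * k + 1))\<^sup>2)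
        + (\<Sum>k<n. (x $ \<sigma> (2 * k))\<^sup>2 * ((x $ \<sigma> (2 * k + 1))\<^sup>2) ^ 11))"
    by (simp only: sum.distrib sum_distrib_left sum_divide_distrib distrib_left add_divide_distrib)
  also have "(\<Sum>k<n. (((x $ \<sigma> (2 * k))\<^sup>2) ^ 12 + ((x $ \<sigma> (2 * k + 1))\<^sup>2) ^ 12)) = (\<Sum>i<2 * n. ((x $ \<sigma> i)\<^sup>2) ^ 12)"
    by (rule sum_lessThan_double[symmetric])
  also have "\<dots> = (\<Sum>i<2 * n. ((x $ i)\<^sup>2) ^ 12)"
    by (rule sum.permute[OF \<sigma>, unfolded o_def, symmetric])
  finally show ?thesis by (simp flip: power_mult)
qed

text \<open>On average the mixed terms become the 22nd moment times the squared norm 1, divided by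
  the dimension. The 22nd moment is then interpolated between the 24th moment and the norm.\<close>

lemma sum_permutes_par_round_power_24_le:
  assumes n: "n > 0" and x: "x \<in> carrier_vec (2 * n)" and x1: "(\<Sum>i<2 * n. (x $ i)\<^sup>2) = 1"
  shows "(\<Sum>\<sigma> | \<sigma> permutes {..<2 * n}. \<Sum>i<2 * n. ((par_round (2 * n) \<sigma> *\<^sub>v x) $ i) ^ 24)
    \<le> fact (2 * n) * ((\<Sum>i<2 * n. (x $ i) ^ 24) / 2 + 2 ^ 240 / real (2 * n) ^ 11)"
proof -
  let ?P = "{\<sigma>. \<sigma> permutes {..<2 * n}}" and ?d = "real (2 * n)"
  let ?S = "\<Sum>i<2 * n. (x $ i) ^ 24" and ?T = "\<Sum>i<2 * n. ((x $ i)\<^sup>2) ^ 11"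
  \<comment> \<open>The threshold for the interpolation: squares above \<open>y\<close> are charged
    to the 24th moment, those below to the norm. The value makes 2^20 / d * (S / y) equal to S / 4,
    which together with the other quarter gives S / 2.\<close>
  define y where "y = 2 ^ 22 / ?d"
  have y: "y > 0" using n by (simp add: y_def)
  have cP: "card ?P = fact (2 * n)" by (rule card_permutations) auto
  have q: "q ^ 11 \<le> q ^ 12 / y + y ^ 10 * q" if q: "q \<ge> 0" for q :: real
  proof (cases "q \<le> y")
    case True
    then have "q ^ 10 * q \<le> y ^ 10 * q" using q by (intro mult_right_mono power_mono) auto
    moreover have "q ^ 11 = q ^ 10 * q" by (simp flip: power_Suc2)
    moreover have "0 \<le> q ^ 12 / y" using y q by simp
    ultimately show ?thesis by linarith
  next
    case False
    then have "q ^ 11 * y \<le> q ^ 11 * q" using q by (intro mult_left_mono) auto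
    then have "q ^ 11 \<le> q ^ 12 / y" using y by (simp add: pos_le_divide_eq flip: power_Suc2)
    moreover have "0 \<le> y ^ 10 * q" using y q by simp
    ultimately show ?thesis by linarith
  qed
  have "?T \<le> (\<Sum>i<2 * n. ((x $ i)\<^sup>2) ^ 12 / y + y ^ 10 * (x $ i)\<^sup>2)"
    by (intro sum_mono q) simp
  also have "\<dots> = ?S / y + y ^ 10"
    by (simp add: sum.distrib x1 sum_divide_distrib[symmetric] sum_distrib_left[symmetric] power_mult[symmetric])
  finally have T: "?T \<le> ?S / y + y ^ 10" .
  have "(\<Sum>\<sigma>\<in>?P. \<Sum>i<2 * n. ((par_round (2 * n) \<sigma> *\<^sub>v x) $ i) ^ 24)
    \<le> (\<Sum>\<sigma>\<in>?P. ?S / 4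
      + 2 ^ 19 * ((\<Sum>k<n. ((x $ \<sigma> (2 * k))\<^sup>2) ^ 11 * (x $ \<sigma> (2 * k + 1))\<^sup>2)
        + (\<Sum>k<n. (x $ \<sigma> (2 * k))\<^sup>2 * ((x $ \<sigma> (2 * k + 1))\<^sup>2) ^ 11)))"
    using x by (intro sum_mono sum_par_round_power_24_le) auto
  also have "\<dots> = fact (2 * n) * (?S / 4)
      + 2 ^ 19 * ((\<Sum>\<sigma>\<in>?P. \<Sum>k<n. ((x $ \<sigma> (2 * k))\<^sup>2) ^ 11 * (x $ \<sigma> (2 * k + 1))\<^sup>2)
        + (\<Sum>\<sigma>\<in>?P. \<Sum>k<n. (x $ \<sigma> (2 * k))\<^sup>2 * ((x $ \<sigma> (2 * k + 1))\<^sup>2) ^ 11))"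
    by (simp only: sum.distrib sum_distrib_left[symmetric] sum_constant cP of_nat_fact)
  also have "\<dots> \<le> fact (2 * n) * (?S / 4)
      + 2 ^ 19 * (fact (2 * n) * (?T * 1) / ?d + fact (2 * n) * (1 * ?T) / ?d)"
    using sum_permutes_pair_le[of "\<lambda>a. ((x $ a)\<^sup>2) ^ 11" "\<lambda>a. (x $ a)\<^sup>2" n]
      sum_permutes_pair_le[of "\<lambda>a. (x $ a)\<^sup>2" "\<lambda>a. ((x $ a)\<^sup>2) ^ 11" n]
    unfolding x1 by (intro add_mono mult_left_mono) auto
  also have "\<dots> = fact (2 * n) * (?S / 4 + 2 ^ 20 / ?d * ?T)" by (simp add: field_simps)
  also have "\<dots> \<le> fact (2 * n) * (?S / 4 + 2 ^ 20 / ?d * (?S / y + y ^ 10))"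
    using T by (intro mult_left_mono add_left_mono) auto
  also have "2 ^ 20 / ?d * (?S / y + y ^ 10) = ?S / 4 + 2 ^ 240 / ?d ^ 11"
  proof -
    have "2 ^ 20 / ?d * (?S / y) = ?S / 4" using n by (simp add: y_def field_simps)
    moreover have "2 ^ 20 / ?d * y ^ 10 = 2 ^ 240 / ?d ^ 11"
      by (simp add: y_def power_divide eval_nat_numeral(3)[of "num.Bit1 num.One"] flip: power_Suc)
    ultimately show ?thesis by (simp only: distrib_left)
  qed
  finally show ?thesis by simp
qed

definition moment_24 :: "nat \<Rightarrow> real mat \<Rightarrow> real" where
  "moment_24 d Q = (\<Sum>j<d. \<Sum>i<d. (Q $$ (i, j)) ^ 24)"

lemma orthogonal_col_norm:
  fixes Q :: "real mat"
  assumes "Q \<in> carrier_mat d d" "transpose_mat Q * Q = 1\<^sub>m d" "j < d"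
  shows "(\<Sum>i<d. (Q $$ (i, j))\<^sup>2) = 1"
proof -
  have "(transpose_mat Q * Q) $$ (j, j) = (\<Sum>i<d. (Q $$ (i, j))\<^sup>2)"
    using assms(1,3) by (simp add: scalar_prod_def lessThan_atLeast0 power2_eq_square)
  with assms show ?thesis by simp
qed

lemma orthogonal_row_norm:
  fixes Q :: "real mat"
  assumes Q: "Q \<in> carrier_mat d d" "transpose_mat Q * Q = 1\<^sub>m d" and i: "i < d"
  shows "(\<Sum>j<d. (Q $$ (i, j))\<^sup>2) = 1"
proof -
  have "Q * transpose_mat Q = 1\<^sub>m d"
    using mat_mult_left_right_inverse[of "transpose_mat Q" d Q] Q by auto
  then show ?thesis
    using orthogonal_col_norm[of "transpose_mat Q" d i] Q i by simp
qed

text \<open>The vector bound applies to each column of \<open>Q\<close>, which is a unit vector.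
  Summing the additive error over the 2n columns turns the exponent 11 into 10.\<close>

lemma sum_permutes_moment_24_le:
  assumes n: "n > 0" and Q: "Q \<in> carrier_mat (2 * n) (2 * n)" "transpose_mat Q * Q = 1\<^sub>m (2 * n)"
  shows "(\<Sum>\<sigma> | \<sigma> permutes {..<2 * n}. moment_24 (2 * n) (par_round (2 * n) \<sigma> * Q))
    \<le> fact (2 * n) * (moment_24 (2 * n) Q / 2 + 2 ^ 240 / real (2 * n) ^ 10)"
proof -
  let ?P = "{\<sigma>. \<sigma> permutes {..<2 * n}}"
  have "(\<Sum>\<sigma>\<in>?P. moment_24 (2 * n) (par_round (2 * n) \<sigma> * Q))
    = (\<Sum>\<sigma>\<in>?P. \<Sum>j<2 * n. \<Sum>i<2 * n. ((par_round (2 * n) \<sigma> *\<^sub>v col Q j) $ i) ^ 24)"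
    using Q(1) par_round_carrier[of "2 * n"] unfolding moment_24_def
    by (intro sum.cong refl) (simp add: par_round_def)
  also have "\<dots> = (\<Sum>j<2 * n. \<Sum>\<sigma>\<in>?P. \<Sum>i<2 * n. ((par_round (2 * n) \<sigma> *\<^sub>v col Q j) $ i) ^ 24)"
    by (rule sum.swap)
  also have "\<dots> \<le> (\<Sum>j<2 * n. fact (2 * n) * ((\<Sum>i<2 * n. (col Q j $ i) ^ 24) / 2 + 2 ^ 240 / real (2 * n) ^ 11))"
  proof (rule sum_mono, rule sum_permutes_par_round_power_24_le[OF n])
    fix j assume "j \<in> {..<2 * n}"
    then show "(\<Sum>i<2 * n. (col Q j $ i)\<^sup>2) = 1"
      using orthogonal_col_norm[OF Q, of j] Q(1) by simp
    show "col Q j \<in> carrier_vec (2 * n)" using Q(1) by (intro carrier_vecI) simp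
  qed
  also have "\<dots> = fact (2 * n) * (moment_24 (2 * n) Q / 2 + real (2 * n) * (2 ^ 240 / real (2 * n) ^ 11))"
    using Q(1) by (simp only: moment_24_def sum_distrib_left[symmetric] sum.distrib sum_divide_distrib[symmetric]
      sum_constant card_lessThan) simp
  also have "real (2 * n) * (2 ^ 240 / real (2 * n) ^ 11) = 2 ^ 240 / real (2 * n) ^ 10"
  proof -
    have "real (2 * n) ^ 11 = real (2 * n) * real (2 * n) ^ 10" by (simp flip: power_Suc)
    then show ?thesis using n by simp
  qed
  finally show ?thesis .
qed

section \<open>The walk as a Markov chain with independent increments\<close>

lemma expectation_bind_pmf_finite:
  fixes h :: "'b \<Rightarrow> real"
  assumes "finite (set_pmf p)" "\<And>x. x \<in> set_pmf p \<Longrightarrow> finite (set_pmf (f x))"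
  shows "measure_pmf.expectation (bind_pmf p f) h
    = measure_pmf.expectation p (\<lambda>x. measure_pmf.expectation (f x) h)"
proof -
  have "measure_pmf.expectation (bind_pmf p f) h
    = (\<Sum>x\<in>set_pmf p. pmf p x *\<^sub>R measure_pmf.expectation (f x) h)"
    using assms by (intro pmf_expectation_bind) auto
  also have "\<dots> = measure_pmf.expectation p (\<lambda>x. measure_pmf.expectation (f x) h)"
    using assms(1) by (intro integral_measure_pmf[symmetric]) auto
  finally show ?thesis .
qed

lemma prob_bind_pmf_finite:
  assumes "finite (set_pmf p)" "\<And>x. x \<in> set_pmf p \<Longrightarrow> finite (set_pmf (f x))"
  shows "measure_pmf.prob (bind_pmf p f) X = measure_pmf.expectation p (\<lambda>x. measure_pmf.prob (f x) X)"
proof -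
  have ind: "measure_pmf.expectation q (indicator X) = measure_pmf.prob q X" for q :: "'b pmf"
    by simp
  show ?thesis
    using expectation_bind_pmf_finite[of p f "indicator X"] assms unfolding ind by blast
qed

lemma expectation_mono_finite:
  fixes f g :: "'a \<Rightarrow> real"
  assumes "finite (set_pmf p)" "\<And>x. x \<in> set_pmf p \<Longrightarrow> f x \<le> g x"
  shows "measure_pmf.expectation p f \<le> measure_pmf.expectation p g"
  using assms by (intro integral_mono_AE integrable_measure_pmf_finite) (auto simp: AE_measure_pmf_iff)

abbreviation unif_perms :: "nat \<Rightarrow> (nat \<Rightarrow> nat) pmf" where
  "unif_perms d \<equiv> pmf_of_set {\<sigma>. \<sigma> permutes {..<d}}"

lemma finite_perms: "finite {\<sigma>. \<sigma> permutes {..<d :: nat}}" "{\<sigma>. \<sigma> permutes {..<d}} \<noteq> {}"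
  using permutes_id[of "{..<d}"] by (blast intro: finite_permutations)+

lemma set_unif_perms: "set_pmf (unif_perms d) = {\<sigma>. \<sigma> permutes {..<d}}"
  using finite_perms by (intro set_pmf_of_set) auto

lemma expectation_unif_perms:
  fixes f :: "_ \<Rightarrow> real"
  shows "measure_pmf.expectation (unif_perms d) f = (\<Sum>\<sigma> | \<sigma> permutes {..<d}. f \<sigma>) / fact d"
  by (subst integral_pmf_of_set[OF finite_perms(2,1)]) (simp add: card_permutations[of "{..<d}" d])

lemma par_walk_cong:
  assumes "\<And>t. t \<in> {1..T} \<Longrightarrow> \<sigma> t = \<tau> t"
  shows "par_walk d \<sigma> T = par_walk d \<tau> T"
  using assms by (induction T) auto

lemma par_walk_pmf_0: "par_walk_pmf d 0 = return_pmf (1\<^sub>m d)"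
  by (simp add: par_walk_pmf_def par_perms_pmf_def)

text \<open>The product law splits off the coordinate \<open>Suc t\<close>, which the first
  \<open>t\<close> rounds do not read. All later probability estimates use this recursion in place
  of the joint law of the permutations.\<close>

lemma par_walk_pmf_Suc:
  "par_walk_pmf d (Suc t) = do {
     Q \<leftarrow> par_walk_pmf d t; \<sigma> \<leftarrow> unif_perms d; return_pmf (par_round d \<sigma> * Q)}"
proof -
  have ins: "{1..Suc t} = insert (Suc t) {1..t}" by auto
  have cong: "par_walk d (f(Suc t := y)) t = par_walk d f t" for f y
    by (rule par_walk_cong) auto
  have "par_walk_pmf d (Suc t) = do {
     y \<leftarrow> unif_perms d; f \<leftarrow> par_perms_pmf d t; return_pmf (par_round d y * par_walk d f t)}"
    unfolding par_walk_pmf_def par_perms_pmf_def ins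
    by (subst Pi_pmf_insert') (auto simp: map_bind_pmf cong map_return_pmf simp del: Un_insert_right)
  also have "\<dots> = do {
     f \<leftarrow> par_perms_pmf d t; y \<leftarrow> unif_perms d; return_pmf (par_round d y * par_walk d f t)}"
    by (rule bind_commute_pmf)
  finally show ?thesis
    by (simp add: par_walk_pmf_def bind_map_pmf)
qed

lemma set_par_walk_pmf:
  assumes "even d" "Q \<in> set_pmf (par_walk_pmf d T)"
  shows "Q \<in> carrier_mat d d" "transpose_mat Q * Q = 1\<^sub>m d"
proof -
  from assms(2) obtain \<sigma> where \<sigma>: "\<sigma> \<in> PiE_dflt {1..T} id (\<lambda>_. {\<sigma>. \<sigma> permutes {..<d}})"
    and Q: "Q = par_walk d \<sigma> T"
    by (auto simp: par_walk_pmf_def par_perms_pmf_def set_Pi_pmf set_unif_perms o_def)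
  have "\<sigma> t permutes {..<d}" if "t \<in> {1..T}" for t
    using \<sigma> that by (auto simp: PiE_dflt_def)
  from par_walk_orthogonal[of d T \<sigma>, OF assms(1) this] show "Q \<in> carrier_mat d d" "transpose_mat Q * Q = 1\<^sub>m d"
    unfolding Q by blast+
qed

lemma finite_set_par_walk_pmf [simp]: "finite (set_pmf (par_walk_pmf d T))"
  by (induction T) (auto simp: par_walk_pmf_0 par_walk_pmf_Suc set_unif_perms finite_perms)

text \<open>The rounds are independent and identically distributed, so the last \<open>s\<close> of
  them form a walk independent of the first \<open>t\<close>. In the induction, associativity of the
  product moves the new round next to \<open>A\<close>, and the draws of \<open>\<sigma>\<close> and
  \<open>B\<close> commute.\<close>

lemma par_walk_pmf_add:
  assumes d: "even d"
  shows "par_walk_pmf d (s + t) = do {A \<leftarrow> par_walk_pmf d s; B \<leftarrow> par_walk_pmf d t; return_pmf (A * B)}"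
proof (induction s)
  case 0
  have "do {B \<leftarrow> par_walk_pmf d t; return_pmf (1\<^sub>m d * B)} = do {B \<leftarrow> par_walk_pmf d t; return_pmf B}"
    by (intro bind_pmf_cong refl) (use set_par_walk_pmf(1)[OF d] in \<open>auto intro: left_mult_one_mat\<close>)
  then show ?case by (simp add: par_walk_pmf_0 bind_return_pmf bind_return_pmf')
next
  case (Suc s)
  have assoc: "par_round d \<sigma> * (A * B) = (par_round d \<sigma> * A) * B"
    if "A \<in> set_pmf (par_walk_pmf d s)" "B \<in> set_pmf (par_walk_pmf d t)" for A B \<sigma>
    using assoc_mult_mat[OF par_round_carrier set_par_walk_pmf(1)[OF d that(1)] set_par_walk_pmf(1)[OF d that(2)]] by simp
  have "par_walk_pmf d (Suc s + t) = do {
      A \<leftarrow> par_walk_pmf d s; B \<leftarrow> par_walk_pmf d t; \<sigma> \<leftarrow> unif_perms d; return_pmf (par_round d \<sigma> * (A * B))}"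
    by (simp add: par_walk_pmf_Suc Suc.IH bind_assoc_pmf bind_return_pmf)
  also have "\<dots> = do {
      A \<leftarrow> par_walk_pmf d s; B \<leftarrow> par_walk_pmf d t; \<sigma> \<leftarrow> unif_perms d; return_pmf ((par_round d \<sigma> * A) * B)}"
    by (intro bind_pmf_cong refl arg_cong[where f = return_pmf] assoc)
  also have "\<dots> = do {
      A \<leftarrow> par_walk_pmf d s; \<sigma> \<leftarrow> unif_perms d; B \<leftarrow> par_walk_pmf d t; return_pmf ((par_round d \<sigma> * A) * B)}"
    by (intro bind_pmf_cong refl bind_commute_pmf)
  also have "\<dots> = do {A \<leftarrow> par_walk_pmf d (Suc s); B \<leftarrow> par_walk_pmf d t; return_pmf (A * B)}"
    by (simp add: par_walk_pmf_Suc bind_assoc_pmf bind_return_pmf)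
  finally show ?case .
qed

section \<open>Resampling one inner round\<close>

text \<open>Both diagonal entries of the rotation are 1 / sqrt 2, so their contribution is a
  multiple of the inner product of a row of \<open>A\<close> and a column of \<open>B\<close>,
  whatever \<open>\<sigma>\<close> is. The off-diagonal entries have opposite signs and give the
  antisymmetric remainder.\<close>

lemma par_round_sandwich_index:
  assumes \<sigma>: "\<sigma> permutes {..<2 * n}"
    and A: "A \<in> carrier_mat (2 * n) (2 * n)" and B: "B \<in> carrier_mat (2 * n) (2 * n)"
    and i: "i < 2 * n" and j: "j < 2 * n"
  shows "(A * (par_round (2 * n) \<sigma> * B)) $$ (i, j)
    = (A * B) $$ (i, j) / sqrt 2 + cross_sum n (\<lambda>a. A $$ (i, a)) (\<lambda>a. B $$ (a, j)) \<sigma>"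
proof -
  let ?u = "\<lambda>a. A $$ (i, a)" and ?v = "\<lambda>a. B $$ (a, j)" and ?R = "par_round (2 * n) \<sigma>"
  have R: "?R \<in> carrier_mat (2 * n) (2 * n)" by (rule par_round_carrier)
  have c: "col B j \<in> carrier_vec (2 * n)" using B by (intro carrier_vecI) simp
  have lt: "\<sigma> l < 2 * n" if "l < 2 * n" for l
    using permutes_in_image[OF \<sigma>, of l] that by simp
  have "(A * (?R * B)) $$ (i, j) = (\<Sum>a<2 * n. ?u a * (?R *\<^sub>v col B j) $ a)"
    using A B R i j by (simp add: scalar_prod_def lessThan_atLeast0)
  also have "\<dots> = (\<Sum>a<2 * n. ?u (\<sigma> a) * (?R *\<^sub>v col B j) $ \<sigma> a)"
    by (rule sum.permute[OF \<sigma>, unfolded o_def])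
  also have "\<dots> = (\<Sum>k<n. ?u (\<sigma> (2 * k)) * (?R *\<^sub>v col B j) $ \<sigma> (2 * k)
      + ?u (\<sigma> (2 * k + 1)) * (?R *\<^sub>v col B j) $ \<sigma> (2 * k + 1))"
    by (rule sum_lessThan_double)
  also have "\<dots> = (\<Sum>k<n. (?u (\<sigma> (2 * k)) * ?v (\<sigma> (2 * k)) + ?u (\<sigma> (2 * k + 1)) * ?v (\<sigma> (2 * k + 1))) / sqrt 2
      + (?u (\<sigma> (2 * k + 1)) * ?v (\<sigma> (2 * k)) - ?u (\<sigma> (2 * k)) * ?v (\<sigma> (2 * k + 1))) / sqrt 2)"
  proof (rule sum.cong[OF refl])
    fix k assume "k \<in> {..<n}"
    then have k: "2 * k < 2 * n" "2 * k + 1 < 2 * n" by auto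
    have e: "even (2 * n)" by simp
    have v: "col B j $ \<sigma> (2 * k) = ?v (\<sigma> (2 * k))" "col B j $ \<sigma> (2 * k + 1) = ?v (\<sigma> (2 * k + 1))"
      using B j lt[OF k(1)] lt[OF k(2)] by auto
    show "?u (\<sigma> (2 * k)) * (?R *\<^sub>v col B j) $ \<sigma> (2 * k)
      + ?u (\<sigma> (2 * k + 1)) * (?R *\<^sub>v col B j) $ \<sigma> (2 * k + 1)
      = (?u (\<sigma> (2 * k)) * ?v (\<sigma> (2 * k)) + ?u (\<sigma> (2 * k + 1)) * ?v (\<sigma> (2 * k + 1))) / sqrt 2
      + (?u (\<sigma> (2 * k + 1)) * ?v (\<sigma> (2 * k)) - ?u (\<sigma> (2 * k)) * ?v (\<sigma> (2 * k + 1))) / sqrt 2"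
      unfolding par_round_action[OF e \<sigma> k(1) c] v by (simp add: field_simps)
  qed
  also have "\<dots> = (\<Sum>k<n. ?u (\<sigma> (2 * k)) * ?v (\<sigma> (2 * k)) + ?u (\<sigma> (2 * k + 1)) * ?v (\<sigma> (2 * k + 1))) / sqrt 2
      + cross_sum n ?u ?v \<sigma>"
    by (simp only: sum.distrib cross_sum_def sum_divide_distrib add_divide_distrib)
  also have "(\<Sum>k<n. ?u (\<sigma> (2 * k)) * ?v (\<sigma> (2 * k)) + ?u (\<sigma> (2 * k + 1)) * ?v (\<sigma> (2 * k + 1)))
      = (\<Sum>a<2 * n. ?u (\<sigma> a) * ?v (\<sigma> a))"
    by (rule sum_lessThan_double[symmetric])
  also have "\<dots> = (\<Sum>a<2 * n. ?u a * ?v a)"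
    by (rule sum.permute[OF \<sigma>, unfolded o_def, symmetric])
  also have "\<dots> = (A * B) $$ (i, j)"
    using A B i j by (simp add: scalar_prod_def lessThan_atLeast0)
  finally show ?thesis .
qed

text \<open>A Chernoff bound with the exponential moments at \<open>l\<close> and
  \<open>- l\<close>; the two tails give the factor 2.\<close>

lemma prob_cross_sum_gt_le:
  fixes u v :: "nat \<Rightarrow> real" and l z :: real
  assumes n: "n > 0" and l0: "l > 0"
    and u1: "(\<Sum>a<2 * n. (u a)\<^sup>2) = 1" and v1: "(\<Sum>a<2 * n. (v a)\<^sup>2) = 1"
    and u: "\<And>a. a < 2 * n \<Longrightarrow> (u a)\<^sup>2 \<le> \<epsilon>" and v: "\<And>a. a < 2 * n \<Longrightarrow> (v a)\<^sup>2 \<le> \<epsilon>"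
    and l: "2 * l\<^sup>2 * \<epsilon>\<^sup>2 \<le> 1"
  shows "measure_pmf.prob (unif_perms (2 * n)) {\<sigma>. \<bar>cross_sum n u v \<sigma>\<bar> > z} \<le> 2 * exp (7 * l\<^sup>2 / real n - l * z)"
proof -
  let ?P = "{\<sigma>. \<sigma> permutes {..<2 * n}}" and ?N = "cross_sum n u v"
  have "measure_pmf.prob (unif_perms (2 * n)) {\<sigma>. \<bar>?N \<sigma>\<bar> > z}
    = measure_pmf.expectation (unif_perms (2 * n)) (indicator {\<sigma>. \<bar>?N \<sigma>\<bar> > z})"
    by simp
  also have "\<dots> = (\<Sum>\<sigma>\<in>?P. indicator {\<sigma>. \<bar>?N \<sigma>\<bar> > z} \<sigma>) / fact (2 * n)"
    by (rule expectation_unif_perms)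
  also have "\<dots> \<le> (\<Sum>\<sigma>\<in>?P. exp (- (l * z)) * (exp (l * ?N \<sigma>) + exp ((- l) * ?N \<sigma>))) / fact (2 * n)"
  proof (intro divide_right_mono sum_mono)
    fix \<sigma>
    have "1 \<le> exp (- (l * z)) * (exp (l * ?N \<sigma>) + exp ((- l) * ?N \<sigma>))" if "\<bar>?N \<sigma>\<bar> > z"
    proof -
      have "l * z \<le> l * \<bar>?N \<sigma>\<bar>" using that l0 by simp
      then have "exp (l * z) \<le> exp (l * \<bar>?N \<sigma>\<bar>)" by simp
      also have "\<dots> \<le> exp (l * ?N \<sigma>) + exp ((- l) * ?N \<sigma>)"
        by (cases "?N \<sigma> \<ge> 0") (auto simp: abs_if less_imp_le)
      finally show ?thesis by (simp add: exp_minus field_simps)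
    qed
    then show "indicator {\<sigma>. \<bar>?N \<sigma>\<bar> > z} \<sigma> \<le> exp (- (l * z)) * (exp (l * ?N \<sigma>) + exp ((- l) * ?N \<sigma>))"
      by (cases "\<bar>?N \<sigma>\<bar> > z") (auto simp: less_imp_le add_pos_pos)
  qed simp
  also have "\<dots> = exp (- (l * z)) * ((\<Sum>\<sigma>\<in>?P. exp (l * ?N \<sigma>)) + (\<Sum>\<sigma>\<in>?P. exp ((- l) * ?N \<sigma>))) / fact (2 * n)"
    by (simp only: sum_distrib_left[symmetric] sum.distrib)
  also have "\<dots> \<le> exp (- (l * z)) * (fact (2 * n) * exp (7 * l\<^sup>2 / real n) + fact (2 * n) * exp (7 * (- l)\<^sup>2 / real n)) / fact (2 * n)"
    using u v l by (intro divide_right_mono mult_left_mono add_mono sum_permutes_exp_cross_sum_le[OF n u1 v1]) auto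
  also have "\<dots> = 2 * exp (7 * l\<^sup>2 / real n - l * z)"
    by (simp add: exp_diff exp_minus field_simps)
  finally show ?thesis .
qed

text \<open>The bad event is phrased entrywise, so that union bounds and the Markov inequality apply
  to it directly.\<close>

definition large_entry :: "nat \<Rightarrow> real \<Rightarrow> real mat set" where
  "large_entry d x = {Q. \<exists>i<d. \<exists>j<d. \<bar>Q $$ (i, j)\<bar> > x}"

lemma not_large_entryD:
  "Q \<notin> large_entry d x \<Longrightarrow> i < d \<Longrightarrow> j < d \<Longrightarrow> \<bar>Q $$ (i, j)\<bar> \<le> x"
  unfolding large_entry_def by (metis (mono_tags, lifting) mem_Collect_eq not_le)

text \<open>A union bound over the entries: since those of \<open>A * B\<close> are at most
  \<open>x\<close>, an entry above x / sqrt 2 + z forces its cross sum beyond \<open>z\<close>.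
  Flatness of \<open>A\<close> and \<open>B\<close> enters with \<open>\<epsilon>\<close> =
  \<open>\<delta>\<^sup>2\<close>.\<close>

lemma prob_par_round_large_entry_le:
  fixes l z x \<delta> :: real
  assumes n: "n > 0" and l0: "l > 0" and \<delta>: "\<delta> \<ge> 0" and l: "2 * l\<^sup>2 * \<delta> ^ 4 \<le> 1"
    and A: "A \<in> carrier_mat (2 * n) (2 * n)" "transpose_mat A * A = 1\<^sub>m (2 * n)" "A \<notin> large_entry (2 * n) \<delta>"
    and B: "B \<in> carrier_mat (2 * n) (2 * n)" "transpose_mat B * B = 1\<^sub>m (2 * n)" "B \<notin> large_entry (2 * n) \<delta>"
    and AB: "A * B \<notin> large_entry (2 * n) x"
  shows "measure_pmf.prob (unif_perms (2 * n))
      {\<sigma>. A * (par_round (2 * n) \<sigma> * B) \<in> large_entry (2 * n) (x / sqrt 2 + z)}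
    \<le> 2 * real (2 * n) ^ 2 * exp (7 * l\<^sup>2 / real n - l * z)"
proof -
  let ?d = "2 * n" and ?M = "measure_pmf (unif_perms (2 * n))"
  let ?I = "{..<?d} \<times> {..<?d}"
  let ?E = "\<lambda>(i, j). {\<sigma>. \<bar>cross_sum n (\<lambda>a. A $$ (i, a)) (\<lambda>a. B $$ (a, j)) \<sigma>\<bar> > z}"
  have small: "(Q $$ (i, j))\<^sup>2 \<le> \<delta>\<^sup>2" if "Q \<notin> large_entry ?d \<delta>" "i < ?d" "j < ?d" for Q i j
    using not_large_entryD[OF that] \<delta> by (simp add: power2_le_iff_abs_le)
  have "measure ?M {\<sigma>. A * (par_round ?d \<sigma> * B) \<in> large_entry ?d (x / sqrt 2 + z)} \<le> measure ?M (\<Union>(?E ` ?I))"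
  proof (rule measure_pmf.finite_measure_mono_AE)
    show "AE \<sigma> in ?M. \<sigma> \<in> {\<sigma>. A * (par_round ?d \<sigma> * B) \<in> large_entry ?d (x / sqrt 2 + z)} \<longrightarrow> \<sigma> \<in> \<Union>(?E ` ?I)"
      unfolding AE_measure_pmf_iff set_unif_perms
    proof (intro ballI impI)
      fix \<sigma> assume "\<sigma> \<in> {\<sigma>. \<sigma> permutes {..<?d}}"
        and "\<sigma> \<in> {\<sigma>. A * (par_round ?d \<sigma> * B) \<in> large_entry ?d (x / sqrt 2 + z)}"
      then obtain i j where \<sigma>: "\<sigma> permutes {..<?d}" and ij: "i < ?d" "j < ?d"
        and big: "\<bar>(A * (par_round ?d \<sigma> * B)) $$ (i, j)\<bar> > x / sqrt 2 + z"
        by (auto simp: large_entry_def)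
      have "\<bar>(A * B) $$ (i, j)\<bar> \<le> x"
        using not_large_entryD[OF AB] ij by blast
      then have "\<bar>(A * B) $$ (i, j) / sqrt 2\<bar> \<le> x / sqrt 2"
        by (simp add: abs_divide divide_right_mono)
      with big have "\<bar>cross_sum n (\<lambda>a. A $$ (i, a)) (\<lambda>a. B $$ (a, j)) \<sigma>\<bar> > z"
        unfolding par_round_sandwich_index[OF \<sigma> A(1) B(1) ij] by linarith
      with ij show "\<sigma> \<in> \<Union>(?E ` ?I)" by auto
    qed
  qed simp
  also have "\<dots> \<le> (\<Sum>ij\<in>?I. measure ?M (?E ij))"
    by (rule measure_UNION_le) auto
  also have "\<dots> \<le> (\<Sum>ij\<in>?I. 2 * exp (7 * l\<^sup>2 / real n - l * z))"
  proof (rule sum_mono, clarsimp simp del: of_nat_mult)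
    fix i j assume ij: "i < ?d" "j < ?d"
    show "measure ?M {\<sigma>. z < \<bar>cross_sum n (\<lambda>a. A $$ (i, a)) (\<lambda>a. B $$ (a, j)) \<sigma>\<bar>}
      \<le> 2 * exp (7 * l\<^sup>2 / real n - l * z)"
      using small A B ij l
      by (intro prob_cross_sum_gt_le[where \<epsilon> = "\<delta>\<^sup>2"] n l0 orthogonal_row_norm orthogonal_col_norm)
        (auto simp: power_mult[symmetric])
  qed
  also have "\<dots> = 2 * real ?d ^ 2 * exp (7 * l\<^sup>2 / real n - l * z)"
    by (simp add: power2_eq_square)
  finally show ?thesis .
qed

text \<open>Condition on the factors \<open>A\<close> and \<open>B\<close> around the cut round. If
  one of them is not flat, or if \<open>A * B\<close> has an entry above \<open>x\<close>, the
  probability is bounded by 1 and charged to the matching indicator. The product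
  \<open>A * B\<close> has the law of the walk without the cut round, which makes the estimate
  recursive.\<close>

lemma prob_par_walk_large_entry_step:
  fixes l z x \<delta> :: real
  assumes n: "n > 0" and l0: "l > 0" and \<delta>: "\<delta> \<ge> 0" and l: "2 * l\<^sup>2 * \<delta> ^ 4 \<le> 1"
  shows "measure_pmf.prob (par_walk_pmf (2 * n) (Suc (s + t))) (large_entry (2 * n) (x / sqrt 2 + z))
    \<le> measure_pmf.prob (par_walk_pmf (2 * n) (s + t)) (large_entry (2 * n) x)
      + measure_pmf.prob (par_walk_pmf (2 * n) s) (large_entry (2 * n) \<delta>)
      + measure_pmf.prob (par_walk_pmf (2 * n) t) (large_entry (2 * n) \<delta>)
      + 2 * real (2 * n) ^ 2 * exp (7 * l\<^sup>2 / real n - l * z)"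
proof -
  let ?d = "2 * n"
  let ?W = "par_walk_pmf ?d" and ?L = "large_entry ?d" and ?U = "unif_perms ?d"
  let ?\<tau> = "2 * real ?d ^ 2 * exp (7 * l\<^sup>2 / real n - l * z)"
  let ?y = "x / sqrt 2 + z"
  have d: "even ?d" by simp
  have fin [simp]: "integrable (measure_pmf (?W r)) f" for f :: "real mat \<Rightarrow> real" and r
    by (rule integrable_measure_pmf_finite) simp
  have finU: "finite (set_pmf ?U)" using finite_perms by (simp add: set_unif_perms)
  have "?W (Suc (s + t)) = do {A \<leftarrow> ?W s; C \<leftarrow> ?W (Suc t); return_pmf (A * C)}"
    using par_walk_pmf_add[OF d, of s "Suc t"] by simp
  also have "\<dots> = do {A \<leftarrow> ?W s; B \<leftarrow> ?W t; map_pmf (\<lambda>\<sigma>. A * (par_round ?d \<sigma> * B)) ?U}"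
    by (simp add: par_walk_pmf_Suc bind_assoc_pmf bind_return_pmf map_pmf_def)
  finally have "measure_pmf.prob (?W (Suc (s + t))) (?L ?y)
    = measure_pmf.expectation (?W s) (\<lambda>A. measure_pmf.expectation (?W t) (\<lambda>B.
        measure_pmf.prob ?U {\<sigma>. A * (par_round ?d \<sigma> * B) \<in> ?L ?y}))"
    using finU by (simp add: prob_bind_pmf_finite vimage_def)
  also have "\<dots> \<le> measure_pmf.expectation (?W s) (\<lambda>A. measure_pmf.expectation (?W t) (\<lambda>B.
        indicator (?L x) (A * B) + indicator (?L \<delta>) A + indicator (?L \<delta>) B + ?\<tau>))"
  proof (intro expectation_mono_finite finite_set_par_walk_pmf)
    fix A B assume "A \<in> set_pmf (?W s)" "B \<in> set_pmf (?W t)"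
    then have A: "A \<in> carrier_mat ?d ?d" "transpose_mat A * A = 1\<^sub>m ?d"
      and B: "B \<in> carrier_mat ?d ?d" "transpose_mat B * B = 1\<^sub>m ?d"
      using set_par_walk_pmf[OF d] by auto
    show "measure_pmf.prob ?U {\<sigma>. A * (par_round ?d \<sigma> * B) \<in> ?L ?y}
      \<le> indicator (?L x) (A * B) + indicator (?L \<delta>) A + indicator (?L \<delta>) B + ?\<tau>" (is "?p \<le> _")
    proof (cases "A \<in> ?L \<delta> \<or> B \<in> ?L \<delta> \<or> A * B \<in> ?L x")
      case True
      have "?p \<le> 1" by simp
      also have "1 \<le> indicator (?L x) (A * B) + indicator (?L \<delta>) A + indicator (?L \<delta>) B + ?\<tau>"
        using True by (auto simp: indicator_def)
      finally show ?thesis .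
    next
      case False
      then have "?p \<le> ?\<tau>"
        using A B by (intro prob_par_round_large_entry_le[OF n l0 \<delta> l]) auto
      then show ?thesis using False by simp
    qed
  qed
  also have "\<dots> = measure_pmf.expectation (?W s) (\<lambda>A. measure_pmf.expectation (?W t) (\<lambda>B. indicator (?L x) (A * B)))
      + measure_pmf.prob (?W s) (?L \<delta>) + measure_pmf.prob (?W t) (?L \<delta>) + ?\<tau>"
    by simp
  also have "measure_pmf.expectation (?W s) (\<lambda>A. measure_pmf.expectation (?W t) (\<lambda>B. indicator (?L x) (A * B)))
      = measure_pmf.prob (?W (s + t)) (?L x)"
    unfolding par_walk_pmf_add[OF d]
    by (simp add: prob_bind_pmf_finite measure_return)
  finally show ?thesis .
qed

section \<open>Weak flatness after logarithmically many rounds\<close>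

lemma moment_24_one: "moment_24 d (1\<^sub>m d) = real d"
proof -
  have "(\<Sum>i<d. (1\<^sub>m d $$ (i, j)) ^ 24) = (1 :: real)" if "j < d" for j
  proof -
    have "(\<Sum>i<d. (1\<^sub>m d $$ (i, j)) ^ 24) = (\<Sum>i<d. if i = j then 1 else (0 :: real))"
      using that by (intro sum.cong) auto
    then show ?thesis using that by simp
  qed
  then show ?thesis by (simp add: moment_24_def)
qed

text \<open>The moment starts at the dimension for the identity and is halved by every round up to
  an additive error; 2^241 / d^10 is the fixed point of e -> e / 2 + 2^240 / d^10.\<close>

lemma expectation_moment_24_le:
  assumes n: "n > 0"
  shows "measure_pmf.expectation (par_walk_pmf (2 * n) t) (moment_24 (2 * n))
    \<le> real (2 * n) / 2 ^ t + 2 ^ 241 / real (2 * n) ^ 10"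
proof (induction t)
  case 0
  show ?case by (simp add: par_walk_pmf_0 moment_24_one)
next
  case (Suc t)
  let ?d = "2 * n" let ?W = "par_walk_pmf ?d" and ?U = "unif_perms ?d"
  have d: "even ?d" by simp
  have finU: "finite (set_pmf ?U)" using finite_perms by (simp add: set_unif_perms)
  have fin [simp]: "integrable (measure_pmf (?W t)) f" for f :: "real mat \<Rightarrow> real"
    by (rule integrable_measure_pmf_finite) simp
  have "measure_pmf.expectation (?W (Suc t)) (moment_24 ?d)
    = measure_pmf.expectation (?W t) (\<lambda>Q. measure_pmf.expectation ?U (\<lambda>\<sigma>. moment_24 ?d (par_round ?d \<sigma> * Q)))"
    using finU by (simp add: par_walk_pmf_Suc expectation_bind_pmf_finite)
  also have "\<dots> \<le> measure_pmf.expectation (?W t) (\<lambda>Q. moment_24 ?d Q / 2 + 2 ^ 240 / real ?d ^ 10)"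
  proof (intro expectation_mono_finite finite_set_par_walk_pmf)
    fix Q assume "Q \<in> set_pmf (?W t)"
    from sum_permutes_moment_24_le[OF n set_par_walk_pmf[OF d this]]
    show "measure_pmf.expectation ?U (\<lambda>\<sigma>. moment_24 ?d (par_round ?d \<sigma> * Q)) \<le> moment_24 ?d Q / 2 + 2 ^ 240 / real ?d ^ 10"
      unfolding expectation_unif_perms by (subst pos_divide_le_eq) (simp_all only: fact_gt_zero mult.commute)
  qed
  also have "\<dots> = measure_pmf.expectation (?W t) (moment_24 ?d) / 2 + 2 ^ 240 / real ?d ^ 10"
    by simp
  also have "\<dots> \<le> (real ?d / 2 ^ t + 2 ^ 241 / real ?d ^ 10) / 2 + 2 ^ 240 / real ?d ^ 10"
    using Suc.IH by simp
  also have "\<dots> = real ?d / 2 ^ Suc t + 2 ^ 241 / real ?d ^ 10"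
    by (simp add: add_divide_distrib)
  finally show ?case .
qed

text \<open>The Markov inequality: the moment sums over all entries, so a single large entry already
  makes it exceed \<open>\<delta> ^ 24\<close>, and no union bound is taken.\<close>

lemma prob_large_entry_le_moment:
  assumes \<delta>: "\<delta> > 0"
  shows "measure_pmf.prob (par_walk_pmf d t) (large_entry d \<delta>)
    \<le> measure_pmf.expectation (par_walk_pmf d t) (moment_24 d) / \<delta> ^ 24"
proof -
  let ?W = "par_walk_pmf d t"
  have nn: "moment_24 d Q \<ge> 0" for Q
    unfolding moment_24_def by (intro sum_nonneg) auto
  have "measure_pmf.prob ?W (large_entry d \<delta>) = measure_pmf.expectation ?W (indicator (large_entry d \<delta>))"
    by simp
  also have "\<dots> \<le> measure_pmf.expectation ?W (\<lambda>Q. moment_24 d Q / \<delta> ^ 24)"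
  proof (intro expectation_mono_finite finite_set_par_walk_pmf)
    fix Q
    have "\<delta> ^ 24 \<le> moment_24 d Q" if "Q \<in> large_entry d \<delta>"
    proof -
      from that obtain i j where ij: "i < d" "j < d" and big: "\<bar>Q $$ (i, j)\<bar> > \<delta>"
        by (auto simp: large_entry_def)
      have "\<delta> ^ 24 \<le> \<bar>Q $$ (i, j)\<bar> ^ 24" using big \<delta> by (intro power_mono) auto
      also have "\<dots> = (Q $$ (i, j)) ^ 24" by (simp add: power_even_abs)
      also have "\<dots> \<le> (\<Sum>i<d. (Q $$ (i, j)) ^ 24)"
        using ij by (intro member_le_sum) auto
      also have "\<dots> \<le> moment_24 d Q"
        unfolding moment_24_def using ij
        by (intro member_le_sum[where f = "\<lambda>j. \<Sum>i<d. (Q $$ (i, j)) ^ 24"]) (auto intro: sum_nonneg)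
      finally show ?thesis .
    qed
    then show "indicator (large_entry d \<delta>) Q \<le> moment_24 d Q / \<delta> ^ 24"
      using nn[of Q] \<delta> by (auto simp: indicator_def)
  qed
  also have "\<dots> = measure_pmf.expectation ?W (moment_24 d) / \<delta> ^ 24"
    by simp
  finally show ?thesis .
qed

section \<open>Iterating the cut and choosing the parameters\<close>

lemma prob_large_entry_mono:
  "x \<le> y \<Longrightarrow> measure_pmf.prob p (large_entry d y) \<le> measure_pmf.prob p (large_entry d x)"
  by (intro measure_pmf.finite_measure_mono) (force simp: large_entry_def)+

text \<open>The columns are unit vectors. This trivial bound is where the iteration starts.\<close>

lemma prob_large_entry_one:
  assumes "even d"
  shows "measure_pmf.prob (par_walk_pmf d T) (large_entry d 1) = 0"
proof -
  have "Q \<notin> large_entry d 1" if Q: "Q \<in> set_pmf (par_walk_pmf d T)" for Q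
  proof
    assume "Q \<in> large_entry d 1"
    then obtain i j where ij: "i < d" "j < d" and big: "\<bar>Q $$ (i, j)\<bar> > 1"
      by (auto simp: large_entry_def)
    have "(Q $$ (i, j))\<^sup>2 \<le> (\<Sum>i<d. (Q $$ (i, j))\<^sup>2)"
      using ij by (intro member_le_sum) auto
    also have "\<dots> = 1"
      using orthogonal_col_norm[OF set_par_walk_pmf[OF assms Q] ij(2)] .
    finally show False using big by (simp add: abs_square_le_1)
  qed
  then show ?thesis by (simp add: measure_pmf_zero_iff) blast
qed

text \<open>Each further round contracts the bound by \<open>1 / \<surd>2\<close> up to an additive error \<open>z\<close>; the fixed
  point of \<open>x \<mapsto> x / \<surd>2 + z\<close> is below \<open>4 * z\<close>.\<close>

lemma prob_par_walk_large_entry_iterate: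
  fixes l z \<delta> p :: real
  assumes n: "n > 0" and l0: "l > 0" and \<delta>: "\<delta> \<ge> 0" and l: "2 * l\<^sup>2 * \<delta> ^ 4 \<le> 1" and z: "z \<ge> 0"
    and flat: "\<And>t. t \<ge> t\<^sub>0 \<Longrightarrow> measure_pmf.prob (par_walk_pmf (2 * n) t) (large_entry (2 * n) \<delta>) \<le> p"
    and T: "T \<ge> 2 * t\<^sub>0"
  shows "measure_pmf.prob (par_walk_pmf (2 * n) (T + m)) (large_entry (2 * n) ((1 / sqrt 2) ^ m + 4 * z))
    \<le> real m * (2 * p + 2 * real (2 * n) ^ 2 * exp (7 * l\<^sup>2 / real n - l * z))"
proof (induction m)
  case 0
  have "measure_pmf.prob (par_walk_pmf (2 * n) T) (large_entry (2 * n) (1 + 4 * z)) \<le> 0"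
    using prob_large_entry_mono[of 1 "1 + 4 * z" "par_walk_pmf (2 * n) T" "2 * n"]
      prob_large_entry_one[of "2 * n" T] z by simp
  then show ?case by simp
next
  case (Suc m)
  let ?P = "\<lambda>t x. measure_pmf.prob (par_walk_pmf (2 * n) t) (large_entry (2 * n) x)"
  let ?x = "(1 / sqrt 2) ^ m + 4 * z"
  \<comment> \<open>The cut leaves \<open>t\<^sub>0\<close> rounds after the cut round and
    \<open>T + m - t\<^sub>0\<close> before it, so both factors are flat. Without the cut round
    there are \<open>T + m\<close> rounds, which is the case of the induction hypothesis.\<close>
  have s: "t\<^sub>0 \<le> T + m - t\<^sub>0" and eq: "T + m = t\<^sub>0 + (T + m - t\<^sub>0)" using T by auto
  have "?x / sqrt 2 + z \<le> (1 / sqrt 2) ^ Suc m + 4 * z"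
  proof -
    \<comment> \<open>With this bound, 4 z / sqrt 2 + z <= 3 z + z.\<close>
    have "4 / 3 \<le> sqrt (2 :: real)" by (rule real_le_rsqrt) (simp add: power2_eq_square)
    then have "4 * z / sqrt 2 \<le> 4 * z / (4 / 3)" using z by (intro divide_left_mono) auto
    then show ?thesis by (simp add: add_divide_distrib)
  qed
  then have "?P (T + Suc m) ((1 / sqrt 2) ^ Suc m + 4 * z) \<le> ?P (Suc (T + m)) (?x / sqrt 2 + z)"
    using prob_large_entry_mono by simp
  also have "\<dots> \<le> ?P (T + m) ?x + ?P t\<^sub>0 \<delta> + ?P (T + m - t\<^sub>0) \<delta>
      + 2 * real (2 * n) ^ 2 * exp (7 * l\<^sup>2 / real n - l * z)"
    using prob_par_walk_large_entry_step[OF n l0 \<delta> l, of t\<^sub>0 "T + m - t\<^sub>0" ?x z] unfolding eq[symmetric] .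
  also have "\<dots> \<le> real m * (2 * p + 2 * real (2 * n) ^ 2 * exp (7 * l\<^sup>2 / real n - l * z)) + p + p
      + 2 * real (2 * n) ^ 2 * exp (7 * l\<^sup>2 / real n - l * z)"
    using Suc.IH flat[OF order_refl] flat[OF s] by (intro add_mono) auto
  also have "\<dots> = real (Suc m) * (2 * p + 2 * real (2 * n) ^ 2 * exp (7 * l\<^sup>2 / real n - l * z))"
    by (simp add: algebra_simps)
  finally show ?case .
qed

text \<open>Of the 23 m rounds, 2 * 11 m guarantee flat factors on both sides of every cut and m are
  spent on the contraction. The constant 97 is 4 * 24 from the fluctuations plus 1 from (1 / sqrt
  2)^m <= 1 / sqrt d.\<close>

lemma prob_par_walk_large_entry_log:
  fixes d n m T :: nat
  assumes d: "d = 2 * n" and lnd: "ln (real d) \<ge> 1" and m: "real d \<le> 2 ^ m" and T: "T \<ge> 23 * m"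
  shows "measure_pmf.prob (par_walk_pmf d T) (large_entry d (97 * sqrt (ln (real d) / real d)))
    \<le> real m * (2 ^ 249 * ln (real d) ^ 6 / real d ^ 4 + 2 / real d ^ 8)"
proof -
  let ?d = "real d"
  have d0: "d > 0" "n > 0" using lnd d by (auto intro!: Nat.gr0I)
  define L where "L = ln ?d"
  have L: "L \<ge> 1" using lnd by (simp add: L_def)
  \<comment> \<open>The order of magnitude that balances 7 l^2 / n = 14 L against l z = 24
    L.\<close>
  define l where "l = sqrt (?d * L)"
  \<comment> \<open>Chosen to give equality in the constraint
    \<open>2 * l\<^sup>2 * \<delta> ^ 4 \<le> 1\<close>.\<close>
  define \<delta> where "\<delta> = sqrt (1 / sqrt (2 * ?d * L))"
  \<comment> \<open>The factor 24 leaves exp (14 L - 24 L) = d^(-10), hence 2 / d^8 after the union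
    bound over the d^2 entries.\<close>
  define z where "z = 24 * sqrt (L / ?d)"
  have l2: "l\<^sup>2 = ?d * L" using L by (simp add: l_def)
  have \<delta>2: "\<delta>\<^sup>2 = 1 / sqrt (2 * ?d * L)" using L by (simp add: \<delta>_def)
  have \<delta>4: "\<delta> ^ 4 = 1 / (2 * ?d * L)"
  proof -
    have "\<delta> ^ 4 = (\<delta>\<^sup>2)\<^sup>2" by (simp flip: power_mult)
    then show ?thesis using L by (simp add: \<delta>2 power_divide)
  qed
  have lz: "l * z = 24 * L"
  proof -
    have "l * z = 24 * (sqrt (?d * L) * sqrt (L / ?d))" by (simp only: l_def z_def mult.left_commute)
    also have "sqrt (?d * L) * sqrt (L / ?d) = sqrt ((?d * L) * (L / ?d))" by (rule real_sqrt_mult[symmetric])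
    also have "(?d * L) * (L / ?d) = L\<^sup>2" using d0 by (simp add: power2_eq_square)
    finally show ?thesis using L by simp
  qed
  \<comment> \<open>This is 2^242 / d^10 divided by \<open>\<delta> ^ 24\<close>, which is (2 d
    L)^(-6). The 24th moment is high enough to leave d^(-4), well below the target d^(-2).\<close>
  define p where "p = 2 ^ 248 * L ^ 6 / ?d ^ 4"
  \<comment> \<open>After 11 m rounds 2^t is at least d^11, so the transient d / 2^t is at most
    d^(-10) and joins the stationary term.\<close>
  have flat: "measure_pmf.prob (par_walk_pmf (2 * n) t) (large_entry (2 * n) \<delta>) \<le> p" if t: "t \<ge> 11 * m" for t
  proof -
    have \<delta>0: "\<delta> > 0" using L d0 by (simp add: \<delta>_def)
    have "?d ^ 11 \<le> (2 ^ m) ^ 11" using m by (intro power_mono) auto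
    also have "\<dots> = 2 ^ (11 * m)" by (simp add: mult.commute flip: power_mult)
    also have "\<dots> \<le> (2 :: real) ^ t" using t by (intro power_increasing) auto
    finally have "?d / 2 ^ t \<le> ?d / ?d ^ 11" using d0 by (intro divide_left_mono) auto
    also have "\<dots> = 1 / ?d ^ 10"
    proof -
      have "?d ^ 11 = ?d * ?d ^ 10" by (simp flip: power_Suc)
      then show ?thesis using d0 by simp
    qed
    finally have "?d / 2 ^ t \<le> 1 / ?d ^ 10" .
    moreover have "1 / ?d ^ 10 + 2 ^ 241 / ?d ^ 10 \<le> 2 ^ 242 / ?d ^ 10"
      unfolding add_divide_distrib[symmetric] by (intro divide_right_mono) auto
    ultimately have "measure_pmf.expectation (par_walk_pmf (2 * n) t) (moment_24 (2 * n)) \<le> 2 ^ 242 / ?d ^ 10"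
      using expectation_moment_24_le[OF d0(2), of t] unfolding d[symmetric] by linarith
    then have "measure_pmf.prob (par_walk_pmf (2 * n) t) (large_entry (2 * n) \<delta>) \<le> 2 ^ 242 / ?d ^ 10 / \<delta> ^ 24"
      using \<delta>0 by (intro order_trans[OF prob_large_entry_le_moment[OF \<delta>0]] divide_right_mono) auto
    also have "\<delta> ^ 24 = 1 / (2 * ?d * L) ^ 6"
    proof -
      have "\<delta> ^ 24 = (\<delta> ^ 4) ^ 6" by (simp flip: power_mult)
      then show ?thesis by (simp add: \<delta>4 power_divide)
    qed
    also have "2 ^ 242 / ?d ^ 10 / (1 / (2 * ?d * L) ^ 6) = p"
    proof -
      have "2 ^ 242 / ?d ^ 10 * (2 * ?d * L) ^ 6 = 2 ^ 248 * L ^ 6 / ?d ^ 4"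
        using d0 by (simp add: power_mult_distrib field_simps)
      then show ?thesis by (simp only: p_def divide_divide_eq_right div_by_1)
    qed
    finally show ?thesis .
  qed
  have exp: "2 * ?d ^ 2 * exp (7 * l\<^sup>2 / real n - l * z) = 2 / ?d ^ 8"
  proof -
    have "7 * l\<^sup>2 / real n = 14 * L" using d0 by (simp add: l2 d)
    then have "7 * l\<^sup>2 / real n - l * z = - (real 10 * L)" by (simp add: lz)
    then have "exp (7 * l\<^sup>2 / real n - l * z) = 1 / exp L ^ 10"
      by (simp only: exp_minus exp_of_nat_mult inverse_eq_divide)
    also have "exp L = ?d" using d0 by (simp add: L_def)
    finally show ?thesis using d0 by (simp add: field_simps)
  qed
  have "(1 / sqrt 2) ^ m \<le> sqrt (L / ?d)"
  proof (rule real_le_rsqrt)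
    have "((1 / sqrt 2) ^ m)\<^sup>2 = ((1 / sqrt 2)\<^sup>2) ^ m" by (simp add: mult.commute flip: power_mult)
    also have "\<dots> = 1 / 2 ^ m" by (simp add: power_divide)
    also have "\<dots> \<le> 1 / ?d" using m d0 by (intro divide_left_mono) auto
    also have "\<dots> \<le> L / ?d" using L by (intro divide_right_mono) auto
    finally show "((1 / sqrt 2) ^ m)\<^sup>2 \<le> L / ?d" .
  qed
  then have "(1 / sqrt 2) ^ m + 4 * z \<le> 97 * sqrt (L / ?d)" by (simp add: z_def)
  then have "measure_pmf.prob (par_walk_pmf d T) (large_entry d (97 * sqrt (L / ?d)))
    \<le> measure_pmf.prob (par_walk_pmf d T) (large_entry d ((1 / sqrt 2) ^ m + 4 * z))"
    by (rule prob_large_entry_mono)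
  also have "\<dots> = measure_pmf.prob (par_walk_pmf (2 * n) ((T - m) + m)) (large_entry (2 * n) ((1 / sqrt 2) ^ m + 4 * z))"
    using T by (simp add: d)
  also have "\<dots> \<le> real m * (2 * p + 2 * real (2 * n) ^ 2 * exp (7 * l\<^sup>2 / real n - l * z))"
  proof (rule prob_par_walk_large_entry_iterate[where t\<^sub>0 = "11 * m" and \<delta> = \<delta>])
    show "l > 0" using L d0 by (simp add: l_def)
    show "\<delta> \<ge> 0" using L by (simp add: \<delta>_def)
    show "2 * l\<^sup>2 * \<delta> ^ 4 \<le> 1" using L d0 by (simp add: l2 \<delta>4)
    show "z \<ge> 0" using L by (simp add: z_def)
    show "2 * (11 * m) \<le> T - m" using T by simp
  qed (use d0 flat in auto)
  also have "\<dots> = real m * (2 ^ 249 * L ^ 6 / ?d ^ 4 + 2 / ?d ^ 8)"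
    using exp by (simp add: d p_def)
  finally show ?thesis by (simp add: L_def)
qed

lemma max_abs_norm_le:
  assumes "Q \<in> carrier_mat d d" "d > 0" "Q \<notin> large_entry d x"
  shows "max_abs_norm Q \<le> x"
proof -
  have eq: "elements_mat Q = (\<lambda>(i, j). Q $$ (i, j)) ` ({..<d} \<times> {..<d})"
    using assms(1) by (auto simp: elements_mat_def)
  show ?thesis
    unfolding max_abs_norm_def eq using assms(2) not_large_entryD[OF assms(3)]
    by (subst Max_le_iff) auto
qed

theorem theorem1p3:
  shows "\<exists>(C::real) (d\<^sub>0::nat). C > 0 \<and>
    (\<forall>d T :: nat. even d \<longrightarrow> d \<ge> d\<^sub>0 \<longrightarrow> real T \<ge> C * ln (real d) \<longrightarrow>
      measure_pmf.prob (par_walk_pmf d T)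
        {Q. max_abs_norm Q \<le> C * sqrt (ln (real d) / real d)} \<ge> 1 - 1 / (real d)\<^sup>2)"
proof -
  \<comment> \<open>The left side is of order (ln d)^7 / d^4, so the size of the constant only
    influences \<open>d\<^sub>0\<close>. The factor 2 ln d + 1 will bound the number
    \<open>m\<close> of contraction rounds.\<close>
  have "\<forall>\<^sub>F d in sequentially. (2 * ln (real d) + 1) * (c * ln (real d) ^ 6 / real d ^ 4 + 2 / real d ^ 8) \<le> 1 / (real d)\<^sup>2"
    if "c > 0" for c :: real
    using that by real_asymp
  from this[of "2 ^ 249"]
  have ev: "\<forall>\<^sub>F d in sequentially. (2 * ln (real d) + 1) * (2 ^ 249 * ln (real d) ^ 6 / real d ^ 4 + 2 / real d ^ 8) \<le> 1 / (real d)\<^sup>2"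
    by simp
  have "\<forall>\<^sub>F d in sequentially. ln (real d) \<ge> 1" by real_asymp
  with ev have "\<forall>\<^sub>F d in sequentially. ln (real d) \<ge> 1 \<and>
    (2 * ln (real d) + 1) * (2 ^ 249 * ln (real d) ^ 6 / real d ^ 4 + 2 / real d ^ 8) \<le> 1 / (real d)\<^sup>2"
    by eventually_elim simp
  then obtain d\<^sub>0 where d\<^sub>0: "\<And>d. d \<ge> d\<^sub>0 \<Longrightarrow> ln (real d) \<ge> 1 \<and>
    (2 * ln (real d) + 1) * (2 ^ 249 * ln (real d) ^ 6 / real d ^ 4 + 2 / real d ^ 8) \<le> 1 / (real d)\<^sup>2"
    unfolding eventually_sequentially by blast
  have "measure_pmf.prob (par_walk_pmf d T) {Q. max_abs_norm Q \<le> 100 * sqrt (ln (real d) / real d)} \<ge> 1 - 1 / (real d)\<^sup>2"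
    if d: "even d" "d \<ge> d\<^sub>0" and T: "real T \<ge> 100 * ln (real d)" for d T :: nat
  proof -
    let ?W = "par_walk_pmf d T" and ?r = "sqrt (ln (real d) / real d)"
    have lnd: "ln (real d) \<ge> 1" and small:
      "(2 * ln (real d) + 1) * (2 ^ 249 * ln (real d) ^ 6 / real d ^ 4 + 2 / real d ^ 8) \<le> 1 / (real d)\<^sup>2"
      using d\<^sub>0[OF d(2)] by auto
    have d0: "d > 0" using lnd by (auto intro!: Nat.gr0I)
    obtain n where n: "d = 2 * n" using d(1) by (rule evenE)
    \<comment> \<open>The least number of rounds with 2^m >= d.\<close>
    define m where "m = nat \<lceil>log 2 (real d)\<rceil>"
    have log: "0 \<le> log 2 (real d)" "log 2 (real d) \<le> 2 * ln (real d)"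
    proof -
      show "0 \<le> log 2 (real d)" using d0 by simp
      have "ln (2 :: real) \<ge> 1 / 2" using ln_one_minus_pos_upper_bound[of "1/2"] by (simp add: ln_div)
      then show "log 2 (real d) \<le> 2 * ln (real d)"
        using lnd by (simp add: log_def field_simps mult_left_mono)
    qed
    have m: "log 2 (real d) \<le> real m" "real m \<le> 2 * ln (real d) + 1"
      using log unfolding m_def by linarith+
    have dm: "real d \<le> 2 ^ m"
      using m(1) d0 by (simp add: log_le_iff powr_realpow)
    \<comment> \<open>Since ln d >= 1, 23 m <= 46 ln d + 23 <= 69 ln d, which is below 100 ln
      d.\<close>
    have "real (23 * m) \<le> real T" using m T lnd by simp
    then have Tm: "23 * m \<le> T" by linarith
    have "1 - measure_pmf.prob ?W {Q. max_abs_norm Q \<le> 100 * ?r}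
      = measure_pmf.prob ?W (- {Q. max_abs_norm Q \<le> 100 * ?r})"
      using measure_pmf.prob_compl[of "{Q. max_abs_norm Q \<le> 100 * ?r}" ?W] by (simp add: Compl_eq_Diff_UNIV)
    also have "\<dots> \<le> measure_pmf.prob ?W (large_entry d (97 * ?r))"
    proof (rule measure_pmf.finite_measure_mono_AE)
      show "AE Q in ?W. Q \<in> - {Q. max_abs_norm Q \<le> 100 * ?r} \<longrightarrow> Q \<in> large_entry d (97 * ?r)"
        unfolding AE_measure_pmf_iff
      proof (intro ballI impI, rule ccontr)
        fix Q assume Q: "Q \<in> set_pmf ?W" "Q \<in> - {Q. max_abs_norm Q \<le> 100 * ?r}" "Q \<notin> large_entry d (97 * ?r)"
        have "max_abs_norm Q \<le> 97 * ?r"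
          using max_abs_norm_le[OF set_par_walk_pmf(1)[OF d(1) Q(1)] d0 Q(3)] .
        also have "\<dots> \<le> 100 * ?r" using lnd by (intro mult_right_mono) auto
        finally show False using Q(2) by simp
      qed
    qed simp
    also have "\<dots> \<le> real m * (2 ^ 249 * ln (real d) ^ 6 / real d ^ 4 + 2 / real d ^ 8)"
      by (rule prob_par_walk_large_entry_log[OF n lnd dm Tm])
    also have "\<dots> \<le> (2 * ln (real d) + 1) * (2 ^ 249 * ln (real d) ^ 6 / real d ^ 4 + 2 / real d ^ 8)"
      using m(2) lnd by (intro mult_right_mono add_nonneg_nonneg) auto
    also note small
    finally show ?thesis by simp
  qed
  then show ?thesis by (intro exI[of _ 100] exI[of _ d\<^sub>0]) simp
qed

end
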